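(* There is an algorithm that decides, for every finite BSR(SLR) clause set, whether it is satisfiable.
   Context: Two-sorted hierarchic setting: a base sort $\mathcal{R}$, always interpreted as $\mathbb{R}$ with its standard arithmetic, and a free sort $\mathcal{S}$. There are countably many base-sort variables and free-sort variables. Linear arithmetic (LA) terms are built with $+$ and $-$ from rational constants, base-sort variables, and base-sort Skolem constants (constant symbols of sort $\mathcal{R}$ whose real value is chosen by the interpretation). There is a finite set of free-sort constant symbols, a finite set of predicate symbols, each with a sort $\xi_1\times\dots\times\xi_k$ with $\xi_i\in\{\mathcal{R},\mathcal{S}\}$, and a built-in equality $\approx$ on $\mathcal{S}$. A BSR(SLR) clause has the form $\Lambda\,\|\,\Gamma\to\Delta$, where $\Lambda,\Gamma,\Delta$ are finite multisets of atoms such that: every atom of $\Lambda$ has the form $s\triangleleft t$, $x\triangleleft t$, or $x\triangleleft y$, where $s,t$ are ground (variable-free) LA terms, $x,y$ are base-sort variables and $\triangleleft\in\{<,\le,=,\ne,\ge,>\}$; every atom of $\Gamma$ and $\Delta$ is either an equation $s\approx s'$ between free-sort variables or free-sort constants, or a well-sorted atom $P(s_1,\dots,s_k)$ whose arguments are base-sort variables, free-sort variables or free-sort constants. The clause stands for the universal closure of $(\bigwedge\Lambda\wedge\bigwedge\Gamma)\to\bigvee\Delta$ (empty $\Delta$ means falsity). An interpretation $\mathcal{A}$ interprets $\mathcal{R}$ as $\mathbb{R}$, assigns a real number to each base-sort Skolem constant, chooses a nonempty set $\mathcal{S}^{\mathcal{A}}$, an element of $\mathcal{S}^{\mathcal{A}}$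 for each free-sort constant, and a relation $P^{\mathcal{A}}\subseteq\xi_1^{\mathcal{A}}\times\dots\times\xi_k^{\mathcal{A}}$ for each predicate symbol $P$; LA terms and constraints are evaluated in the standard way. $\mathcal{A}$ is a model of a clause if the clause holds in $\mathcal{A}$ under every sort-respecting variable assignment, and a model of a clause set if it is a model of every clause in it. A clause set is satisfiable if it has a model. *)

theory Defs
  imports Complex_Main "HOL-Library.Multiset" "HOL-Library.Nat_Bijection"
begin

section \<open>BSR(SLR) clauses\<close>

text \<open>
  Symbols and variables are named by natural numbers. Base-sort variables, free-sort variables,
  base-sort Skolem constants, free-sort constants and predicate symbols are kept apart by the
  constructors, so the same number may be used for several of them.
\<close>

datatype sort = Base | Free

record signature =
  free_constants :: "nat set"
  predicates :: "nat \<Rightarrow> sort list option"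

definition finite_signature :: "signature \<Rightarrow> bool" where
  "finite_signature \<Sigma> \<longleftrightarrow> finite (free_constants \<Sigma>) \<and> finite (dom (predicates \<Sigma>))"

datatype la_term =
    Rational rat
  | BaseVar nat
  | Skolem nat
  | Plus la_term la_term
  | Minus la_term la_term

primrec ground :: "la_term \<Rightarrow> bool" where
  "ground (Rational q) \<longleftrightarrow> True"
| "ground (BaseVar x) \<longleftrightarrow> False"
| "ground (Skolem c) \<longleftrightarrow> True"
| "ground (Plus s t) \<longleftrightarrow> ground s \<and> ground t"
| "ground (Minus s t) \<longleftrightarrow> ground s \<and> ground t"

definition is_base_var :: "la_term \<Rightarrow> bool" where
  "is_base_var t \<longleftrightarrow> (\<exists>x. t = BaseVar x)"

datatype comparison = Less | Less_Eq | Equal | Not_Equal | Greater_Eq | Greater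

datatype la_atom = Compare comparison la_term la_term

fun slr_atom :: "la_atom \<Rightarrow> bool" where
  "slr_atom (Compare r s t) \<longleftrightarrow>
     (ground s \<and> ground t) \<or> (is_base_var s \<and> ground t) \<or> (is_base_var s \<and> is_base_var t)"

datatype free_term = FreeVar nat | FreeConst nat

datatype argument = BaseArg nat | FreeArg free_term
  \<comment> \<open>\<open>BaseArg x\<close> is the base-sort variable \<open>x\<close>\<close>

datatype free_atom = Eq free_term free_term | Pred nat "argument list"

datatype clause = Clause (constraint: "la_atom multiset")
  (antecedent: "free_atom multiset") (succedent: "free_atom multiset")

fun wf_free_term :: "signature \<Rightarrow> free_term \<Rightarrow> bool" where
  "wf_free_term \<Sigma> (FreeVar u) \<longleftrightarrow> True"
| "wf_free_term \<Sigma> (FreeConst c) \<longleftrightarrow> c \<in> free_constants \<Sigma>"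

fun wf_argument :: "signature \<Rightarrow> argument \<Rightarrow> sort \<Rightarrow> bool" where
  "wf_argument \<Sigma> (BaseArg x) \<xi> \<longleftrightarrow> \<xi> = Base"
| "wf_argument \<Sigma> (FreeArg t) \<xi> \<longleftrightarrow> \<xi> = Free \<and> wf_free_term \<Sigma> t"

fun wf_free_atom :: "signature \<Rightarrow> free_atom \<Rightarrow> bool" where
  "wf_free_atom \<Sigma> (Eq s t) \<longleftrightarrow> wf_free_term \<Sigma> s \<and> wf_free_term \<Sigma> t"
| "wf_free_atom \<Sigma> (Pred P args) \<longleftrightarrow>
     (\<exists>\<xi>s. predicates \<Sigma> P = Some \<xi>s \<and> list_all2 (wf_argument \<Sigma>) args \<xi>s)"

definition bsr_slr_clause :: "signature \<Rightarrow> clause \<Rightarrow> bool" where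
  "bsr_slr_clause \<Sigma> C \<longleftrightarrow>
     (\<forall>a \<in># constraint C. slr_atom a) \<and>
     (\<forall>a \<in># antecedent C. wf_free_atom \<Sigma> a) \<and>
     (\<forall>a \<in># succedent C. wf_free_atom \<Sigma> a)"

definition finite_bsr_slr_clause_set :: "signature \<Rightarrow> clause set \<Rightarrow> bool" where
  "finite_bsr_slr_clause_set \<Sigma> N \<longleftrightarrow> finite N \<and> (\<forall>C \<in> N. bsr_slr_clause \<Sigma> C)"


section \<open>Semantics\<close>

datatype 's element = Real real | Elem 's

text \<open>The base sort is always interpreted by the real numbers; \<open>universe\<close> interprets the free sort.\<close>

record 's interpretation_data =
  universe :: "'s set"
  skolem_value :: "nat \<Rightarrow> real"
  constant_value :: "nat \<Rightarrow> 's"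
  relation :: "nat \<Rightarrow> 's element list set"

fun sort_domain :: "'s interpretation_data \<Rightarrow> sort \<Rightarrow> 's element set" where
  "sort_domain A Base = range Real"
| "sort_domain A Free = Elem ` universe A"

definition is_interpretation :: "signature \<Rightarrow> 's interpretation_data \<Rightarrow> bool" where
  "is_interpretation \<Sigma> A \<longleftrightarrow>
     universe A \<noteq> {} \<and>
     (\<forall>c \<in> free_constants \<Sigma>. constant_value A c \<in> universe A) \<and>
     (\<forall>P \<xi>s. predicates \<Sigma> P = Some \<xi>s \<longrightarrow>
        relation A P \<subseteq> {vs. list_all2 (\<lambda>v \<xi>. v \<in> sort_domain A \<xi>) vs \<xi>s})"

primrec la_value :: "'s interpretation_data \<Rightarrow> (nat \<Rightarrow> real) \<Rightarrow> la_term \<Rightarrow> real" where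
  "la_value A \<beta> (Rational q) = of_rat q"
| "la_value A \<beta> (BaseVar x) = \<beta> x"
| "la_value A \<beta> (Skolem c) = skolem_value A c"
| "la_value A \<beta> (Plus s t) = la_value A \<beta> s + la_value A \<beta> t"
| "la_value A \<beta> (Minus s t) = la_value A \<beta> s - la_value A \<beta> t"

primrec compare :: "comparison \<Rightarrow> real \<Rightarrow> real \<Rightarrow> bool" where
  "compare Less a b \<longleftrightarrow> a < b"
| "compare Less_Eq a b \<longleftrightarrow> a \<le> b"
| "compare Equal a b \<longleftrightarrow> a = b"
| "compare Not_Equal a b \<longleftrightarrow> a \<noteq> b"
| "compare Greater_Eq a b \<longleftrightarrow> a \<ge> b"
| "compare Greater a b \<longleftrightarrow> a > b"

fun holds_la :: "'s interpretation_data \<Rightarrow> (nat \<Rightarrow> real) \<Rightarrow> la_atom \<Rightarrow> bool" where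
  "holds_la A \<beta> (Compare r s t) \<longleftrightarrow> compare r (la_value A \<beta> s) (la_value A \<beta> t)"

primrec free_value :: "'s interpretation_data \<Rightarrow> (nat \<Rightarrow> 's) \<Rightarrow> free_term \<Rightarrow> 's" where
  "free_value A \<gamma> (FreeVar u) = \<gamma> u"
| "free_value A \<gamma> (FreeConst c) = constant_value A c"

primrec argument_value ::
    "'s interpretation_data \<Rightarrow> (nat \<Rightarrow> real) \<Rightarrow> (nat \<Rightarrow> 's) \<Rightarrow> argument \<Rightarrow> 's element" where
  "argument_value A \<beta> \<gamma> (BaseArg x) = Real (\<beta> x)"
| "argument_value A \<beta> \<gamma> (FreeArg t) = Elem (free_value A \<gamma> t)"

primrec holds_free ::
    "'s interpretation_data \<Rightarrow> (nat \<Rightarrow> real) \<Rightarrow> (nat \<Rightarrow> 's) \<Rightarrow> free_atom \<Rightarrow> bool" where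
  "holds_free A \<beta> \<gamma> (Eq s t) \<longleftrightarrow> free_value A \<gamma> s = free_value A \<gamma> t"
| "holds_free A \<beta> \<gamma> (Pred P args) \<longleftrightarrow> map (argument_value A \<beta> \<gamma>) args \<in> relation A P"

definition models_clause :: "'s interpretation_data \<Rightarrow> clause \<Rightarrow> bool" where
  "models_clause A C \<longleftrightarrow>
     (\<forall>\<beta> \<gamma>. range \<gamma> \<subseteq> universe A \<longrightarrow>
        (\<forall>a \<in># constraint C. holds_la A \<beta> a) \<and> (\<forall>a \<in># antecedent C. holds_free A \<beta> \<gamma> a) \<longrightarrow>
        (\<exists>a \<in># succedent C. holds_free A \<beta> \<gamma> a))"

text \<open>
  The type argument is the type from which the universe of the free sort is drawn. HOL cannot
  quantify over this type inside a formula. Satisfiability by an arbitrary interpretation is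
  therefore rendered by \<open>satisfiable TYPE(nat)\<close> where a model is asserted to exist, and by the
  negation of \<open>satisfiable TYPE('s)\<close>, with a type variable \<open>'s\<close>, where it is denied.
\<close>

definition satisfiable :: "'s itself \<Rightarrow> signature \<Rightarrow> clause set \<Rightarrow> bool" where
  "satisfiable _ \<Sigma> N \<longleftrightarrow>
     (\<exists>A :: 's interpretation_data. is_interpretation \<Sigma> A \<and> (\<forall>C \<in> N. models_clause A C))"


section \<open>Algorithms: partial recursive functions\<close>

datatype recf =
    Zero
  | Succ
  | Proj nat
  | Comp recf "recf list"
  | PrimRec recf recf
  | Mu recf

text \<open>\<open>computes f xs y\<close>: on the arguments \<open>xs\<close>, the evaluation of \<open>f\<close> terminates with result \<open>y\<close>.\<close>

inductive computes :: "recf \<Rightarrow> nat list \<Rightarrow> nat \<Rightarrow> bool" where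
  zero: "computes Zero xs 0"
| succ: "computes Succ [x] (Suc x)"
| proj: "i < length xs \<Longrightarrow> computes (Proj i) xs (xs ! i)"
| comp: "list_all2 (\<lambda>g y. computes g xs y) gs ys \<Longrightarrow> computes f ys z \<Longrightarrow>
    computes (Comp f gs) xs z"
| primrec_zero: "computes f xs y \<Longrightarrow> computes (PrimRec f g) (0 # xs) y"
| primrec_suc: "computes (PrimRec f g) (n # xs) y \<Longrightarrow> computes g (n # y # xs) z \<Longrightarrow>
    computes (PrimRec f g) (Suc n # xs) z"
| mu: "computes f (n # xs) 0 \<Longrightarrow> (\<forall>m<n. \<exists>k. computes f (m # xs) (Suc k)) \<Longrightarrow>
    computes (Mu f) xs n"

lemma computes_deterministic:
  "computes f xs y \<Longrightarrow> computes f xs z \<Longrightarrow> y = z"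
proof (induction arbitrary: z rule: computes.induct)
  case (comp xs gs ys f v)
  from comp.prems obtain zs where
    zs: "list_all2 (\<lambda>g y. computes g xs y) gs zs" "computes f zs z"
    by (cases rule: computes.cases) auto
  have "ys = zs"
  proof (rule nth_equalityI)
    show "length ys = length zs"
      using comp.IH(1) zs(1) by (auto dest!: list_all2_lengthD)
    fix i assume "i < length ys"
    then show "ys ! i = zs ! i"
      using comp.IH(1) zs(1) by (auto simp: list_all2_conv_all_nth)
  qed
  then show ?case using comp.IH(2) zs(2) by simp
next
  case (mu f n xs)
  from mu.prems have z: "computes f (z # xs) 0" "\<forall>m<z. \<exists>k. computes f (m # xs) (Suc k)"
    by (cases rule: computes.cases; auto)+
  show ?case
  proof (rule linorder_cases[of n z])
    assume "n < z"
    then show ?thesis using mu.IH(1) z(2) by fastforce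
  next
    assume "z < n"
    then show ?thesis using mu.IH(2) z(1) by fastforce
  qed
next
  case (zero xs)
  from zero.prems show ?case by (cases rule: computes.cases) auto
next
  case (succ x)
  from succ.prems show ?case by (cases rule: computes.cases) auto
next
  case (proj i xs)
  from proj.prems show ?case by (cases rule: computes.cases) auto
next
  case (primrec_zero f xs y g)
  from primrec_zero.prems show ?case
    by (cases rule: computes.cases) (auto dest: primrec_zero.IH)
next
  case (primrec_suc f g n xs y v)
  from primrec_suc.prems show ?case
    by (cases rule: computes.cases) (auto dest: primrec_suc.IH)
qed


section \<open>Presenting clause sets to an algorithm\<close>

text \<open>
  A presentation lists the clauses, and the atoms of each clause, in an arbitrary order and with
  arbitrary repetitions of clauses.
\<close>

type_synonym presented_clause = "la_atom list \<times> free_atom list \<times> free_atom list"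

fun clause_of :: "presented_clause \<Rightarrow> clause" where
  "clause_of (ls, gs, ds) = Clause (mset ls) (mset gs) (mset ds)"

definition presents :: "presented_clause list \<Rightarrow> clause set \<Rightarrow> bool" where
  "presents w N \<longleftrightarrow> set (map clause_of w) = N"

lemma ex_presentation:
  assumes "finite N"
  shows "\<exists>w. presents w N"
proof -
  have "surj clause_of"
  proof (rule surjI)
    fix C
    show "clause_of (SOME p. clause_of p = C) = C"
      by (rule someI_ex, cases C) (metis clause_of.simps ex_mset)
  qed
  moreover obtain Cs where "set Cs = N" using assms finite_list by blast
  ultimately have "presents (map (inv clause_of) Cs) N"
    by (simp add: presents_def image_comp surj_f_inv_f)
  then show ?thesis ..
qed

text \<open>Constructors are coded as pairs of a tag and the code of the arguments.\<close>

definition encode_rat :: "rat \<Rightarrow> nat" where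
  "encode_rat q =
     (case quotient_of q of (a, b) \<Rightarrow> prod_encode (int_encode a, int_encode b))"

primrec encode_la_term :: "la_term \<Rightarrow> nat" where
  "encode_la_term (Rational q) = prod_encode (0, encode_rat q)"
| "encode_la_term (BaseVar x) = prod_encode (1, x)"
| "encode_la_term (Skolem c) = prod_encode (2, c)"
| "encode_la_term (Plus s t) = prod_encode (3, prod_encode (encode_la_term s, encode_la_term t))"
| "encode_la_term (Minus s t) = prod_encode (4, prod_encode (encode_la_term s, encode_la_term t))"

primrec encode_comparison :: "comparison \<Rightarrow> nat" where
  "encode_comparison Less = 0"
| "encode_comparison Less_Eq = 1"
| "encode_comparison Equal = 2"
| "encode_comparison Not_Equal = 3"
| "encode_comparison Greater_Eq = 4"
| "encode_comparison Greater = 5"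

primrec encode_la_atom :: "la_atom \<Rightarrow> nat" where
  "encode_la_atom (Compare r s t) =
     prod_encode (encode_comparison r, prod_encode (encode_la_term s, encode_la_term t))"

primrec encode_free_term :: "free_term \<Rightarrow> nat" where
  "encode_free_term (FreeVar u) = prod_encode (0, u)"
| "encode_free_term (FreeConst c) = prod_encode (1, c)"

primrec encode_argument :: "argument \<Rightarrow> nat" where
  "encode_argument (BaseArg x) = prod_encode (0, x)"
| "encode_argument (FreeArg t) = prod_encode (1, encode_free_term t)"

primrec encode_free_atom :: "free_atom \<Rightarrow> nat" where
  "encode_free_atom (Eq s t) =
     prod_encode (0, prod_encode (encode_free_term s, encode_free_term t))"
| "encode_free_atom (Pred P args) =
     prod_encode (1, prod_encode (P, list_encode (map encode_argument args)))"

fun encode_clause :: "presented_clause \<Rightarrow> nat" where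
  "encode_clause (ls, gs, ds) =
     prod_encode (list_encode (map encode_la_atom ls),
       prod_encode (list_encode (map encode_free_atom gs), list_encode (map encode_free_atom ds)))"

definition encode :: "presented_clause list \<Rightarrow> nat" where
  "encode w = list_encode (map encode_clause w)"

lemma inj_encode: "inj encode"
proof -
  have list: "list_encode (map f xs) = list_encode (map f ys) \<longleftrightarrow> xs = ys"
    if "\<And>x y. f x = f y \<longleftrightarrow> x = y" for f :: "'b \<Rightarrow> nat" and xs ys
    using that by (simp add: list_encode_eq inj_map_eq_map inj_def)
  have rat: "encode_rat q = encode_rat r \<longleftrightarrow> q = r" for q r
    by (auto simp: encode_rat_def prod_encode_eq int_encode_eq split: prod.splits
        intro: quotient_of_inject)
  have la_term: "encode_la_term s = encode_la_term t \<longleftrightarrow> s = t" for s t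
  proof (induction s arbitrary: t)
    case (Rational q)
    show ?case by (cases t) (auto simp: prod_encode_eq rat)
  next
    case (BaseVar x)
    show ?case by (cases t) (auto simp: prod_encode_eq)
  next
    case (Skolem c)
    show ?case by (cases t) (auto simp: prod_encode_eq)
  next
    case (Plus s1 s2)
    then show ?case by (cases t) (auto simp: prod_encode_eq)
  next
    case (Minus s1 s2)
    then show ?case by (cases t) (auto simp: prod_encode_eq)
  qed
  have comparison: "encode_comparison r = encode_comparison r' \<longleftrightarrow> r = r'" for r r'
    by (cases r; cases r') auto
  have la_atom: "encode_la_atom a = encode_la_atom b \<longleftrightarrow> a = b" for a b
    by (cases a; cases b) (auto simp: prod_encode_eq la_term comparison)
  have free_term: "encode_free_term s = encode_free_term t \<longleftrightarrow> s = t" for s t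
    by (cases s; cases t) (auto simp: prod_encode_eq)
  have argument: "encode_argument s = encode_argument t \<longleftrightarrow> s = t" for s t
    by (cases s; cases t) (auto simp: prod_encode_eq free_term)
  have free_atom: "encode_free_atom a = encode_free_atom b \<longleftrightarrow> a = b" for a b
    by (cases a; cases b) (auto simp: prod_encode_eq free_term list[OF argument])
  have clause: "encode_clause c = encode_clause d \<longleftrightarrow> c = d" for c d
    by (cases c; cases d) (auto simp: prod_encode_eq list[OF la_atom] list[OF free_atom])
  show ?thesis
    by (simp add: inj_def encode_def list[OF clause])
qed

end

theory Submission
  imports Defs "HOL-Library.Ramsey"
begin

text \<open>
  Let \<open>\<A>\<close> be a model. All clauses are universal, so the free sort may be shrunk to the values of its
  constants. The values of the ground terms cut the reals into finitely many points and open
  intervals. Choose an increasing sequence inside every interval. By Ramsey's theorem there is an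
  infinite set of indices such that the truth of an atom whose base-sort arguments are points or
  sequence members with indices from this set depends only on the intervals and the order of the
  arguments. Hence there is a model in which the relations depend only on these data; it is described
  by a finite table, and clauses need to be checked only for base-sort variables ranging over a
  finite set. Conversely, such a table gives a model, provided that the order of the ground terms is
  realised by some choice of the Skolem constants. If it is, then it is realised by rational numbers
  of bounded size. So satisfiability is equivalent to a formula with bounded quantifiers.
\<close>

section \<open>Closure properties of recursive functions\<close>

text \<open>Constraints compare base-sort variables only with one another and with ground terms, so
  they survive every order-preserving change of the base-sort values that keeps the ground values in
  place. Both directions exploit this, passing between reals and natural numbers called positions.
  The obstacle is the predicates: in an arbitrary model they may separate any two reals, even inside
  one interval. Ramsey's theorem supplies values on which they do not.

  The second obstacle is that the Skolem constants range over the reals. Bounded integer solutions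
  of sign conditions take the place of quantifier elimination, so no unbounded search is needed.
  Every rational in the input is an integer multiple of \<open>1 / fact e\<close>, where
  \<open>e\<close> is the code of the input; this is the origin of the factorials.

  A model over any type yields the table, and the table yields a model over \<open>nat\<close>,
  which settles from which type the free sort may be drawn.\<close>

definition recursive_on :: "nat \<Rightarrow> (nat list \<Rightarrow> nat) \<Rightarrow> bool" where
  "recursive_on k f \<longleftrightarrow> (\<exists>p. \<forall>xs. length xs = k \<longrightarrow> computes p xs (f xs))"

definition recursive :: "(nat \<Rightarrow> nat) \<Rightarrow> bool" where
  "recursive f \<longleftrightarrow> recursive_on 1 (\<lambda>xs. f (xs ! 0))"

definition recursive2 :: "(nat \<Rightarrow> nat \<Rightarrow> nat) \<Rightarrow> bool" where
  "recursive2 f \<longleftrightarrow> recursive_on 2 (\<lambda>xs. f (xs ! 0) (xs ! 1))"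

definition recursive3 :: "(nat \<Rightarrow> nat \<Rightarrow> nat \<Rightarrow> nat) \<Rightarrow> bool" where
  "recursive3 f \<longleftrightarrow> recursive_on 3 (\<lambda>xs. f (xs ! 0) (xs ! 1) (xs ! 2))"

lemma recursiveI: "(\<And>x. computes p [x] (f x)) \<Longrightarrow> recursive f"
  unfolding recursive_def recursive_on_def
  by (rule exI[of _ p]) (auto simp: length_Suc_conv)

lemma recursiveE:
  assumes "recursive f"
  obtains p where "\<forall>x. computes p [x] (f x)"
proof -
  from assms obtain p where "\<And>xs. length xs = 1 \<Longrightarrow> computes p xs (f (xs ! 0))"
    unfolding recursive_def recursive_on_def by blast
  from this[of "[x]" for x] show ?thesis by (intro that[of p]) simp
qed

lemma recursive2E:
  assumes "recursive2 f"
  obtains p where "\<forall>x y. computes p [x, y] (f x y)"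
proof -
  from assms obtain p where "\<And>xs. length xs = 2 \<Longrightarrow> computes p xs (f (xs ! 0) (xs ! 1))"
    unfolding recursive2_def recursive_on_def by blast
  from this[of "[x, y]" for x y] show ?thesis by (intro that[of p]) simp
qed

lemma recursive3E:
  assumes "recursive3 f"
  obtains p where "\<forall>x y z. computes p [x, y, z] (f x y z)"
proof -
  from assms obtain p
    where "\<And>xs. length xs = 3 \<Longrightarrow> computes p xs (f (xs ! 0) (xs ! 1) (xs ! 2))"
    unfolding recursive3_def recursive_on_def by blast
  from this[of "[x, y, z]" for x y z] show ?thesis by (intro that[of p]) simp
qed

lemma recursive_onE:
  assumes "recursive_on k f"
  obtains p where "\<forall>xs. length xs = k \<longrightarrow> computes p xs (f xs)"
  using assms unfolding recursive_on_def by blast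

section \<open>Composition and primitive recursion\<close>

lemma recursive_on_nth: "i < k \<Longrightarrow> recursive_on k (\<lambda>xs. xs ! i)"
  unfolding recursive_on_def by (rule exI[of _ "Proj i"]) (auto intro: computes.proj)

lemma recursive_on_comp:
  assumes "recursive f" "recursive_on k g"
  shows "recursive_on k (\<lambda>xs. f (g xs))"
proof -
  obtain p where p: "\<forall>x. computes p [x] (f x)" using assms(1) by (rule recursiveE)
  obtain q where q: "\<forall>xs. length xs = k \<longrightarrow> computes q xs (g xs)"
    using assms(2) by (rule recursive_onE)
  have "computes (Comp p [q]) xs (f (g xs))" if "length xs = k" for xs
    by (rule computes.comp[OF _ p[rule_format]]) (use q that in simp)
  then show ?thesis unfolding recursive_on_def by blast
qed

lemma recursive_on_comp2:
  assumes "recursive2 f" "recursive_on k g" "recursive_on k h"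
  shows "recursive_on k (\<lambda>xs. f (g xs) (h xs))"
proof -
  obtain p where p: "\<forall>x y. computes p [x, y] (f x y)" using assms(1) by (rule recursive2E)
  obtain q where q: "\<forall>xs. length xs = k \<longrightarrow> computes q xs (g xs)"
    using assms(2) by (rule recursive_onE)
  obtain r where r: "\<forall>xs. length xs = k \<longrightarrow> computes r xs (h xs)"
    using assms(3) by (rule recursive_onE)
  have "computes (Comp p [q, r]) xs (f (g xs) (h xs))" if "length xs = k" for xs
    by (rule computes.comp[OF _ p[rule_format]]) (use q r that in simp)
  then show ?thesis unfolding recursive_on_def by blast
qed

lemma recursive_Suc': "recursive Suc"
  by (rule recursiveI, rule computes.succ)

lemma recursive_on_const: "recursive_on k (\<lambda>_. c)"
proof (induction c)
  case 0
  show ?case unfolding recursive_on_def by (blast intro: computes.zero)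
next
  case (Suc c)
  then show ?case by (rule recursive_on_comp[OF recursive_Suc'])
qed

lemma recursive2_rec_nat:
  assumes "recursive f" "recursive3 g"
  shows "recursive2 (\<lambda>n x. rec_nat (f x) (\<lambda>m r. g m r x) n)"
proof -
  obtain p where p: "\<forall>x. computes p [x] (f x)" using assms(1) by (rule recursiveE)
  obtain q where q: "\<forall>x y z. computes q [x, y, z] (g x y z)"
    using assms(2) by (rule recursive3E)
  have *: "computes (PrimRec p q) [n, x] (rec_nat (f x) (\<lambda>m r. g m r x) n)" for n x
  proof (induction n)
    case 0
    show ?case using computes.primrec_zero[OF p[rule_format]] by simp
  next
    case (Suc n)
    from computes.primrec_suc[OF this q[rule_format]] show ?case by simp
  qed
  show ?thesis unfolding recursive2_def recursive_on_def
    by (rule exI[of _ "PrimRec p q"]) (auto simp: length_Suc_conv numeral_2_eq_2 *)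
qed

lemma recursive_comp: "recursive f \<Longrightarrow> recursive g \<Longrightarrow> recursive (\<lambda>x. f (g x))"
  unfolding recursive_def[of g] recursive_def[of "\<lambda>x. f (g x)"] by (rule recursive_on_comp)

lemma recursive_comp2:
  "recursive2 f \<Longrightarrow> recursive g \<Longrightarrow> recursive h \<Longrightarrow> recursive (\<lambda>x. f (g x) (h x))"
  unfolding recursive_def by (rule recursive_on_comp2)

lemma recursive_id: "recursive (\<lambda>x. x)"
  unfolding recursive_def by (rule recursive_on_nth) simp

lemma recursive_const: "recursive (\<lambda>_. c)"
  unfolding recursive_def by (rule recursive_on_const)

lemma recursive_rec_nat':
  assumes "recursive2 g"
  shows "recursive (\<lambda>n. rec_nat a g n)"
proof -
  have "recursive3 (\<lambda>m r x. g m r)"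
    unfolding recursive3_def by (intro recursive_on_comp2[OF assms] recursive_on_nth) simp_all
  from recursive_comp2[OF recursive2_rec_nat[OF recursive_const this] recursive_id recursive_id]
  show ?thesis .
qed

section \<open>Arithmetic and the Cantor pairing function\<close>

lemma recursive2_add: "recursive2 (+)"
proof -
  have "recursive3 (\<lambda>m r x. Suc r)"
    unfolding recursive3_def by (intro recursive_on_comp[OF recursive_Suc'] recursive_on_nth) simp
  note * = recursive2_rec_nat[OF recursive_id this]
  have "rec_nat x (\<lambda>m. Suc) n = n + x" for n x by (induction n) simp_all
  with * show ?thesis by (simp add: fun_eq_iff[symmetric])
qed

lemma recursive_pred: "recursive (\<lambda>n. n - 1)"
proof -
  have "recursive2 (\<lambda>m r. m)"
    unfolding recursive2_def by (rule recursive_on_nth) simp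
  note * = recursive_rec_nat'[OF this, of 0]
  have "rec_nat 0 (\<lambda>m r. m) n = n - 1" for n by (cases n) simp_all
  with * show ?thesis by simp
qed

lemma recursive2_diff: "recursive2 (-)"
proof -
  have "recursive3 (\<lambda>m r x. r - 1)"
    unfolding recursive3_def by (intro recursive_on_comp[OF recursive_pred] recursive_on_nth) simp
  note * = recursive2_rec_nat[OF recursive_id this]
  have "rec_nat x (\<lambda>m r. r - 1) n = x - n" for n x by (induction n) simp_all
  with * have "recursive2 (\<lambda>n x. x - n)" by simp
  from recursive_on_comp2[OF this, of 2 "\<lambda>xs. xs ! 1" "\<lambda>xs. xs ! 0"] show ?thesis
    unfolding recursive2_def[of "(-)"] by (simp add: recursive_on_nth)
qed

lemma recursive2_mult: "recursive2 (*)"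
proof -
  have "recursive3 (\<lambda>m r x. r + x)"
    unfolding recursive3_def
    by (intro recursive_on_comp2[OF recursive2_add] recursive_on_nth) simp_all
  note * = recursive2_rec_nat[OF recursive_const[of 0] this]
  have "rec_nat 0 (\<lambda>m r. r + x) n = n * x" for n x by (induction n) simp_all
  with * show ?thesis by (simp add: fun_eq_iff[symmetric])
qed

lemma recursive_triangle: "recursive triangle"
proof -
  have "recursive2 (\<lambda>m r. r + Suc m)"
    unfolding recursive2_def
    by (intro recursive_on_comp2[OF recursive2_add] recursive_on_nth
        recursive_on_comp[OF recursive_Suc']) simp_all
  note * = recursive_rec_nat'[OF this, of 0]
  have "rec_nat 0 (\<lambda>m r. r + Suc m) n = triangle n" for n by (induction n) simp_all
  with * show ?thesis by simp
qed

lemma recursive2_prod_encode: "recursive2 (\<lambda>m n. prod_encode (m, n))"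
  unfolding recursive2_def prod_encode_def
  by (simp, intro recursive_on_comp2[OF recursive2_add] recursive_on_nth
      recursive_on_comp[OF recursive_triangle]) simp_all

definition pfst :: "nat \<Rightarrow> nat" where "pfst n = fst (prod_decode n)"
definition psnd :: "nat \<Rightarrow> nat" where "psnd n = snd (prod_decode n)"

lemma pfst_prod_encode [simp]: "pfst (prod_encode (a, b)) = a"
  and psnd_prod_encode [simp]: "psnd (prod_encode (a, b)) = b"
  by (simp_all add: pfst_def psnd_def)

lemma prod_encode_pfst_psnd: "prod_encode (pfst n, psnd n) = n"
  by (simp add: pfst_def psnd_def)

text \<open>The index of the diagonal of the Cantor pairing on which \<open>n\<close> lies, found by
  counting up: the truncated difference \<open>1 - (...)\<close> is 1 exactly when the next triangle
  number has been reached.\<close>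

definition triangle_root :: "nat \<Rightarrow> nat" where
  "triangle_root n = rec_nat 0 (\<lambda>m r. r + (1 - (triangle (Suc r) - Suc m))) n"

lemma triangle_root_bounds:
  "triangle (triangle_root n) \<le> n \<and> n < triangle (Suc (triangle_root n))"
proof (induction n)
  case 0
  show ?case by (simp add: triangle_root_def)
next
  case (Suc n)
  have "triangle_root (Suc n)
      = triangle_root n + (1 - (triangle (Suc (triangle_root n)) - Suc n))"
    by (simp add: triangle_root_def)
  then show ?case
    using Suc by (cases "triangle (Suc (triangle_root n)) = Suc n") auto
qed

lemma triangle_mono: "m \<le> n \<Longrightarrow> triangle m \<le> triangle n"
  by (induction n rule: dec_induct) simp_all

lemma triangle_root_prod_encode: "triangle_root (prod_encode (a, b)) = a + b"
proof (rule ccontr)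
  assume *: "triangle_root (prod_encode (a, b)) \<noteq> a + b"
  let ?t = "triangle_root (prod_encode (a, b))"
  have b: "triangle ?t \<le> triangle (a + b) + a" "triangle (a + b) + a < triangle (Suc ?t)"
    using triangle_root_bounds[of "prod_encode (a, b)"] by (simp_all add: prod_encode_def)
  show False
  proof (cases "?t < a + b")
    case True
    then show ?thesis using triangle_mono[of "Suc ?t" "a + b"] b(2) by simp
  next
    case False
    then show ?thesis using triangle_mono[of "Suc (a + b)" ?t] b(1) * by simp
  qed
qed

lemma recursive_triangle_root: "recursive triangle_root"
proof -
  have "recursive2 (\<lambda>m r. r + (1 - (triangle (Suc r) - Suc m)))"
    unfolding recursive2_def
    by (intro recursive_on_comp2[OF recursive2_add] recursive_on_comp2[OF recursive2_diff]
        recursive_on_const recursive_on_nth recursive_on_comp[OF recursive_triangle]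
        recursive_on_comp[OF recursive_Suc']) simp_all
  from recursive_rec_nat'[OF this] show ?thesis unfolding triangle_root_def .
qed

text \<open>\<open>prod_encode (a, b)\<close> is \<open>triangle (a + b) + a\<close>, and the root
  recovers the diagonal \<open>a + b\<close>. This gives a closed form in place of the recursion of
  \<open>prod_decode\<close>.\<close>

lemma pfst_eq: "pfst n = n - triangle (triangle_root n)"
proof -
  have "pfst (prod_encode (a, b))
      = prod_encode (a, b) - triangle (triangle_root (prod_encode (a, b)))" for a b
    unfolding triangle_root_prod_encode pfst_prod_encode by (simp add: prod_encode_def)
  from this[of "pfst n" "psnd n"] show ?thesis by (simp only: prod_encode_pfst_psnd)
qed

lemma psnd_eq: "psnd n = triangle_root n - pfst n"
proof -
  have "psnd (prod_encode (a, b)) = triangle_root (prod_encode (a, b)) - pfst (prod_encode (a, b))"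
    for a b unfolding triangle_root_prod_encode by simp
  from this[of "pfst n" "psnd n"] show ?thesis by (simp only: prod_encode_pfst_psnd)
qed

lemma recursive_pfst: "recursive f \<Longrightarrow> recursive (\<lambda>x. pfst (f x))"
  unfolding pfst_eq
  by (intro recursive_comp2[OF recursive2_diff] recursive_comp[OF recursive_triangle]
      recursive_comp[OF recursive_triangle_root])

lemma recursive_psnd: "recursive f \<Longrightarrow> recursive (\<lambda>x. psnd (f x))"
  unfolding psnd_eq
  by (intro recursive_comp2[OF recursive2_diff] recursive_pfst
      recursive_comp[OF recursive_triangle_root])

text \<open>The step function may depend on the parameter \<open>x\<close>. It is required to be
  recursive as a unary function of counter, previous value and parameter packed together, the form
  that the closure rules can prove.\<close>

lemma recursive_rec_nat:
  assumes "recursive f" "recursive b"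
    "recursive (\<lambda>z. g (pfst z) (pfst (psnd z)) (psnd (psnd z)))"
  shows "recursive (\<lambda>x. rec_nat (f x) (\<lambda>m r. g m r x) (b x))"
proof -
  let ?h = "\<lambda>z. g (pfst z) (pfst (psnd z)) (psnd (psnd z))"
  have "recursive3 (\<lambda>m r x. ?h (prod_encode (m, prod_encode (r, x))))"
    unfolding recursive3_def
    by (intro recursive_on_comp[OF assms(3)] recursive_on_comp2[OF recursive2_prod_encode]
        recursive_on_nth) simp_all
  then have "recursive3 (\<lambda>m r x. g m r x)" by simp
  from recursive_comp2[OF recursive2_rec_nat[OF assms(1) this] assms(2) recursive_id]
  show ?thesis .
qed

lemmas recursive_Suc = recursive_comp[OF recursive_Suc']
lemmas recursive_add = recursive_comp2[OF recursive2_add]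
lemmas recursive_diff = recursive_comp2[OF recursive2_diff]
lemmas recursive_mult = recursive_comp2[OF recursive2_mult]
lemmas recursive_prod_encode = recursive_comp2[OF recursive2_prod_encode]

lemma recursive_power:
  assumes "recursive f" "recursive g"
  shows "recursive (\<lambda>x. f x ^ g x)"
proof -
  have "rec_nat 1 (\<lambda>m r. r * a) n = a ^ n" for a n :: nat by (induction n) simp_all
  moreover have "recursive (\<lambda>x. rec_nat 1 (\<lambda>m r. r * f x) (g x))"
    by (rule recursive_rec_nat[where g = "\<lambda>m r x. r * f x"])
      (intro recursive_const assms recursive_mult recursive_pfst recursive_psnd recursive_id
        recursive_comp[OF assms(1)])+
  ultimately show ?thesis by simp
qed

lemma recursive_fact:
  assumes "recursive f"
  shows "recursive (\<lambda>x. fact (f x))"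
proof -
  have "rec_nat 1 (\<lambda>m r. Suc m * r) n = fact n" for n by (induction n) simp_all
  moreover have "recursive (\<lambda>x. rec_nat 1 (\<lambda>m r. Suc m * r) (f x))"
    by (rule recursive_rec_nat[where g = "\<lambda>m r x. Suc m * r"])
      (intro recursive_const assms recursive_mult recursive_Suc recursive_pfst recursive_psnd
        recursive_id)+
  ultimately show ?thesis by simp
qed

lemma recursive_funpow:
  assumes "recursive F" "recursive n" "recursive f"
  shows "recursive (\<lambda>x. (F ^^ n x) (f x))"
proof -
  have "rec_nat a (\<lambda>m r. F r) k = (F ^^ k) a" for a k by (induction k) simp_all
  moreover have "recursive (\<lambda>x. rec_nat (f x) (\<lambda>m r. F r) (n x))"
    by (rule recursive_rec_nat[where g = "\<lambda>m r x. F r"])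
      (intro assms recursive_comp[OF assms(1)] recursive_pfst recursive_psnd recursive_id)+
  ultimately show ?thesis by simp
qed

section \<open>Decidable predicates and bounded quantifiers\<close>

definition decidable :: "(nat \<Rightarrow> bool) \<Rightarrow> bool" where
  "decidable P \<longleftrightarrow> recursive (\<lambda>x. of_bool (P x))"

lemma recursive_if:
  assumes "decidable P" "recursive f" "recursive g"
  shows "recursive (\<lambda>x. if P x then f x else g x)"
proof -
  have "recursive (\<lambda>x. of_bool (P x) * f x + (1 - of_bool (P x)) * g x)"
    using assms unfolding decidable_def
    by (intro recursive_add recursive_mult recursive_diff recursive_const)
  moreover have "(\<lambda>x. of_bool (P x) * f x + (1 - of_bool (P x)) * g x)
      = (\<lambda>x. if P x then f x else g x)" by auto
  ultimately show ?thesis by simp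
qed

lemma decidable_not: "decidable P \<Longrightarrow> decidable (\<lambda>x. \<not> P x)"
proof -
  assume "decidable P"
  then have "recursive (\<lambda>x. 1 - of_bool (P x))"
    unfolding decidable_def by (intro recursive_diff recursive_const)
  moreover have "(\<lambda>x. 1 - of_bool (P x)) = (\<lambda>x. of_bool (\<not> P x) :: nat)" by auto
  ultimately show ?thesis by (simp add: decidable_def)
qed

lemma decidable_conj: "decidable P \<Longrightarrow> decidable Q \<Longrightarrow> decidable (\<lambda>x. P x \<and> Q x)"
  using recursive_mult[of "\<lambda>x. of_bool (P x)" "\<lambda>x. of_bool (Q x)"]
  by (simp add: decidable_def of_bool_conj)

lemma decidable_imp: "decidable P \<Longrightarrow> decidable Q \<Longrightarrow> decidable (\<lambda>x. P x \<longrightarrow> Q x)"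
  using decidable_not[OF decidable_conj[OF _ decidable_not], of P Q] by simp

lemma decidable_iff: "decidable P \<Longrightarrow> decidable Q \<Longrightarrow> decidable (\<lambda>x. P x \<longleftrightarrow> Q x)"
  using decidable_conj[OF decidable_imp[of P Q] decidable_imp[of Q P]]
  by (simp add: iff_conv_conj_imp)

lemma decidable_le: "recursive f \<Longrightarrow> recursive g \<Longrightarrow> decidable (\<lambda>x. f x \<le> g x)"
proof -
  assume "recursive f" "recursive g"
  then have "recursive (\<lambda>x. 1 - (f x - g x))" by (intro recursive_diff recursive_const)
  moreover have "(\<lambda>x. 1 - (f x - g x)) = (\<lambda>x. of_bool (f x \<le> g x))" by auto
  ultimately show ?thesis by (simp add: decidable_def)
qed

lemma decidable_less: "recursive f \<Longrightarrow> recursive g \<Longrightarrow> decidable (\<lambda>x. f x < g x)"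
  using decidable_le[OF recursive_Suc, of f g] by (simp add: Suc_le_eq)

lemma decidable_eq: "recursive f \<Longrightarrow> recursive g \<Longrightarrow> decidable (\<lambda>x. f x = g x)"
  using decidable_conj[OF decidable_le[of f g] decidable_le[of g f]]
  by (simp add: eq_iff[of "_ :: nat"])

lemma decidable_if:
  "decidable P \<Longrightarrow> decidable Q \<Longrightarrow> decidable R \<Longrightarrow> decidable (\<lambda>x. if P x then Q x else R x)"
  using recursive_if[of P "\<lambda>x. of_bool (Q x)" "\<lambda>x. of_bool (R x)"]
  by (simp add: decidable_def if_distrib)

text \<open>A binary predicate is handled as a unary one on pairs, bound variable first, parameter
  second. Substitution into the pair is what allows bounded quantifiers to be nested.\<close>

lemma decidable_comp:
  assumes "decidable (\<lambda>z. P (pfst z) (psnd z))" "recursive f" "recursive g"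
  shows "decidable (\<lambda>x. P (f x) (g x))"
  using recursive_comp[OF assms(1)[unfolded decidable_def]
      recursive_prod_encode[OF assms(2,3)]]
  by (simp add: decidable_def)

lemma decidable_all_less:
  assumes "recursive b" "decidable (\<lambda>z. P (pfst z) (psnd z))"
  shows "decidable (\<lambda>x. \<forall>y<b x. P y x)"
proof -
  have "rec_nat (1 :: nat) (\<lambda>m r. if P m x then r else 0) n = of_bool (\<forall>y<n. P y x)" for x n
    by (induction n) (auto simp: less_Suc_eq)
  moreover have "recursive (\<lambda>x. rec_nat 1 (\<lambda>m r. if P m x then r else 0) (b x))"
    by (rule recursive_rec_nat[where g = "\<lambda>m r x. if P m x then r else 0"])
      (intro recursive_const assms recursive_if decidable_comp[OF assms(2)] recursive_pfst
        recursive_psnd recursive_id)+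
  ultimately show ?thesis by (simp only: decidable_def)
qed

lemma decidable_all_le:
  assumes "recursive b" "decidable (\<lambda>z. P (pfst z) (psnd z))"
  shows "decidable (\<lambda>x. \<forall>y\<le>b x. P y x)"
  using decidable_all_less[OF recursive_Suc[OF assms(1)] assms(2)] by (simp add: less_Suc_eq_le)

lemma decidable_ex_less:
  assumes "recursive b" "decidable (\<lambda>z. P (pfst z) (psnd z))"
  shows "decidable (\<lambda>x. \<exists>y<b x. P y x)"
  using decidable_not[OF decidable_all_less[OF assms(1) decidable_not[OF assms(2)]]] by simp

lemma decidable_ex_le:
  assumes "recursive b" "decidable (\<lambda>z. P (pfst z) (psnd z))"
  shows "decidable (\<lambda>x. \<exists>y\<le>b x. P y x)"
  using decidable_not[OF decidable_all_le[OF assms(1) decidable_not[OF assms(2)]]] by simp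

lemma recursive_div:
  assumes "recursive f" "recursive g"
  shows "recursive (\<lambda>x. f x div g x)"
proof -
  \<comment> \<open>The quotient is carried along while the dividend grows and increases when the
    next multiple of \<open>k\<close> is reached. For \<open>k = 0\<close> it would increase at
    every step, so that case is split off below.\<close>
  have "rec_nat 0 (\<lambda>m r. if Suc r * k \<le> Suc m then Suc r else r) n = n div k" if "k > 0" for k n
  proof (induction n)
    case (Suc n)
    have "Suc n div k = (if Suc (n div k) * k \<le> Suc n then Suc (n div k) else n div k)"
    proof (cases "Suc (n div k) * k \<le> Suc n")
      case True
      then have "Suc (n div k) \<le> Suc n div k" using that by (simp add: less_eq_div_iff_mult_less_eq)
      then show ?thesis using True by (simp add: div_Suc split: if_splits)
    next
      case False
      then have "Suc n div k < Suc (n div k)" using that by (simp add: div_less_iff_less_mult)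
      then show ?thesis using False by (simp add: div_Suc split: if_splits)
    qed
    then show ?case using Suc by simp
  qed simp
  then have "(if g x = 0 then 0
      else rec_nat 0 (\<lambda>m r. if Suc r * g x \<le> Suc m then Suc r else r) (f x)) = f x div g x" for x
    by simp
  moreover have "recursive (\<lambda>x. if g x = 0 then 0
      else rec_nat 0 (\<lambda>m r. if Suc r * g x \<le> Suc m then Suc r else r) (f x))"
    by (intro recursive_if decidable_eq recursive_const assms
        recursive_rec_nat[where g = "\<lambda>m r x. if Suc r * g x \<le> Suc m then Suc r else r"]
        decidable_le recursive_mult recursive_Suc recursive_pfst recursive_psnd recursive_id
        recursive_comp[OF assms(2)])
  ultimately show ?thesis by simp
qed

lemma recursive_mod:
  assumes "recursive f" "recursive g"
  shows "recursive (\<lambda>x. f x mod g x)"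
  using recursive_diff[OF assms(1) recursive_mult[OF recursive_div[OF assms] assms(2)]]
  by (simp add: minus_div_mult_eq_mod)

lemmas recursive_intros =
  recursive_const recursive_id recursive_Suc recursive_add recursive_diff recursive_mult
  recursive_power recursive_fact recursive_div recursive_mod recursive_prod_encode
  recursive_pfst recursive_psnd recursive_if
  decidable_not decidable_conj decidable_imp decidable_iff decidable_le decidable_less
  decidable_eq decidable_if decidable_all_less decidable_all_le decidable_ex_less decidable_ex_le

lemma decidable_computes:
  assumes "decidable P"
  shows "\<exists>p. \<forall>x. if P x then computes p [x] 1 else computes p [x] 0"
proof -
  obtain p where "\<forall>x. computes p [x] (of_bool (P x))"
    using assms unfolding decidable_def by (rule recursiveE)
  then show ?thesis by (metis of_bool_eq(1) of_bool_eq(2))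
qed


section \<open>Small integer solutions of sign conditions on linear forms\<close>

text \<open>The bound of one elimination step. Comparing two roots by cross-multiplication needs
  forms with coefficients up to \<open>2 * c^2\<close>; the new coordinate has a denominator of at
  most \<open>2 * c^2\<close>, by which everything is multiplied; and
  \<open>k * c * height_bound k (2 * c^2)\<close> bounds a form at the old coordinates.\<close>

primrec height_bound :: "nat \<Rightarrow> nat \<Rightarrow> nat" where
  "height_bound 0 c = 0"
| "height_bound (Suc k) c = 2 * c^2 * (k * c * height_bound k (2 * c^2) + 1)"

text \<open>The second argument changes in the recursion above; here the recursion runs from the bottom,
  with the argument of the \<open>j\<close>-th step recomputed.\<close>

lemma height_bound_rec_nat:
  "height_bound k c = rec_nat 0 (\<lambda>j h. 2 * (((\<lambda>c. 2 * c^2) ^^ (k - Suc j)) c)^2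
     * (j * ((\<lambda>c. 2 * c^2) ^^ (k - Suc j)) c * h + 1)) k"
proof -
  let ?s = "\<lambda>c::nat. 2 * c^2"
  have "j \<le> k \<Longrightarrow> rec_nat 0 (\<lambda>j h. 2 * ((?s ^^ (k - Suc j)) c)^2
     * (j * (?s ^^ (k - Suc j)) c * h + 1)) j = height_bound j ((?s ^^ (k - j)) c)" for j
  proof (induction j)
    case (Suc j)
    then have "(?s ^^ (k - j)) c = ?s ((?s ^^ (k - Suc j)) c)"
      by (simp add: Suc_diff_Suc[symmetric] del: funpow.simps(2)) simp
    then show ?case using Suc by simp
  qed simp
  from this[of k] show ?thesis by simp
qed

lemma recursive_height_bound:
  assumes "recursive f" "recursive g"
  shows "recursive (\<lambda>x. height_bound (f x) (g x))"
proof -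
  let ?s = "\<lambda>c::nat. 2 * c^2"
  have s: "recursive ?s" by (intro recursive_intros)
  show ?thesis unfolding height_bound_rec_nat
    by (rule recursive_rec_nat[where g = "\<lambda>j h x. 2 * ((?s ^^ (f x - Suc j)) (g x))^2
         * (j * (?s ^^ (f x - Suc j)) (g x) * h + 1)"])
      (intro recursive_intros assms recursive_funpow[OF s] recursive_comp[OF assms(1)]
        recursive_comp[OF assms(2)])+
qed

text \<open>A number is one of the roots, lies between two neighbouring roots, or lies beyond all of
  them. The corresponding place is a root, a midpoint, or an outermost root shifted by 1. The common
  shape of the witness keeps its denominator under control.\<close>

lemma sgn_eq_transfer:
  fixes x v :: real
  assumes "finite R" "R \<noteq> {}"
    and mono: "\<And>r s. r \<in> R \<Longrightarrow> s \<in> R \<Longrightarrow> (\<rho> r < \<rho> s \<longleftrightarrow> \<rho>' r < (\<rho>' s :: real))"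
  shows "\<exists>l\<in>R. \<exists>h\<in>R. \<exists>s\<in>{-1, 0, 1 :: int}.
    \<forall>r\<in>R. sgn ((\<rho>' l + \<rho>' h) / 2 + s - \<rho>' r) = sgn (v - \<rho> r)"
proof (cases "\<exists>r\<in>R. \<rho> r = v")
  case True
  then obtain r0 where r0: "r0 \<in> R" "\<rho> r0 = v" by blast
  have "sgn (\<rho>' r0 - \<rho>' r) = sgn (\<rho> r0 - \<rho> r)" if "r \<in> R" for r
    using mono[OF r0(1) that] mono[OF that r0(1)] by (auto simp: sgn_real_def)
  then show ?thesis using r0 by (intro bexI[of _ r0] bexI[of _ 0]) auto
next
  case False
  define Lo where "Lo = {r\<in>R. \<rho> r < v}"
  define Up where "Up = {r\<in>R. v < \<rho> r}"
  have fin: "finite Lo" "finite Up" using assms(1) by (auto simp: Lo_def Up_def)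
  have un: "R = Lo \<union> Up" using False by (force simp: Lo_def Up_def)
  have l: "\<exists>l\<in>Lo. \<forall>r\<in>Lo. \<rho>' r \<le> \<rho>' l" if "Lo \<noteq> {}"
  proof -
    have "Max (\<rho>' ` Lo) \<in> \<rho>' ` Lo" using fin(1) that by (intro Max_in) auto
    then obtain l where "l \<in> Lo" "Max (\<rho>' ` Lo) = \<rho>' l" by blast
    then show ?thesis using fin(1) by (metis Max_ge finite_imageI imageI)
  qed
  have h: "\<exists>h\<in>Up. \<forall>r\<in>Up. \<rho>' h \<le> \<rho>' r" if "Up \<noteq> {}"
  proof -
    have "Min (\<rho>' ` Up) \<in> \<rho>' ` Up" using fin(2) that by (intro Min_in) auto
    then obtain h where "h \<in> Up" "Min (\<rho>' ` Up) = \<rho>' h" by blast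
    then show ?thesis using fin(2) by (metis Min_le finite_imageI imageI)
  qed
  have lu: "\<rho>' r < \<rho>' s" if "r \<in> Lo" "s \<in> Up" for r s
    using that mono[of r s] by (auto simp: Lo_def Up_def)
  consider "Lo = {}" "Up \<noteq> {}" | "Up = {}" "Lo \<noteq> {}" | "Lo \<noteq> {}" "Up \<noteq> {}"
    using un assms(2) by blast
  then show ?thesis
  proof cases
    case 1
    then obtain h where h: "h \<in> Up" "\<forall>r\<in>Up. \<rho>' h \<le> \<rho>' r" using h by blast
    have "sgn ((\<rho>' h + \<rho>' h) / 2 + real_of_int (- 1) - \<rho>' r) = sgn (v - \<rho> r)" if "r \<in> R" for r
    proof -
      have "r \<in> Up" using un that 1 by blast
      then have "v < \<rho> r" "\<rho>' h \<le> \<rho>' r" using h by (auto simp: Up_def)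
      then show ?thesis by (simp add: sgn_real_def)
    qed
    then show ?thesis using h(1) un by blast
  next
    case 2
    then obtain l where l: "l \<in> Lo" "\<forall>r\<in>Lo. \<rho>' r \<le> \<rho>' l" using l by blast
    have "sgn ((\<rho>' l + \<rho>' l) / 2 + real_of_int 1 - \<rho>' r) = sgn (v - \<rho> r)" if "r \<in> R" for r
    proof -
      have "r \<in> Lo" using un that 2 by blast
      then have "\<rho> r < v" "\<rho>' r \<le> \<rho>' l" using l by (auto simp: Lo_def)
      then show ?thesis by (simp add: sgn_real_def)
    qed
    then show ?thesis using l(1) un by blast
  next
    case 3
    obtain l where l: "l \<in> Lo" "\<forall>r\<in>Lo. \<rho>' r \<le> \<rho>' l" using l 3 by blast
    obtain h where h: "h \<in> Up" "\<forall>r\<in>Up. \<rho>' h \<le> \<rho>' r" using h 3 by blast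
    have lh: "\<rho>' l < \<rho>' h" using lu l h by blast
    have "sgn ((\<rho>' l + \<rho>' h) / 2 + real_of_int 0 - \<rho>' r) = sgn (v - \<rho> r)" if "r \<in> R" for r
    proof (cases "r \<in> Lo")
      case True
      then have "\<rho> r < v" "\<rho>' r \<le> \<rho>' l" using l by (auto simp: Lo_def)
      then show ?thesis using lh by (simp add: sgn_real_def)
    next
      case False
      then have "r \<in> Up" using un that by blast
      then have "v < \<rho> r" "\<rho>' h \<le> \<rho>' r" using h by (auto simp: Up_def)
      then show ?thesis using lh by (simp add: sgn_real_def)
    qed
    then show ?thesis using l(1) h(1) un by blast
  qed
qed

lemma abs_linear_form_le:
  fixes a u :: "nat \<Rightarrow> int"
  assumes "\<forall>j<k. \<bar>a j\<bar> \<le> c" "\<forall>j<k. \<bar>u j\<bar> \<le> g" "c \<ge> 0" "g \<ge> 0"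
  shows "\<bar>\<Sum>j<k. a j * u j\<bar> \<le> int k * c * g"
proof -
  have "\<bar>\<Sum>j<k. a j * u j\<bar> \<le> (\<Sum>j<k. \<bar>a j * u j\<bar>)" by (rule sum_abs)
  also have "\<dots> \<le> (\<Sum>j<k. c * g)"
    by (rule sum_mono) (use assms in \<open>auto simp: abs_mult intro!: mult_mono\<close>)
  finally show ?thesis by simp
qed

text \<open>In the induction step the new coordinate has to be placed relative to the roots of the forms in
  that coordinate. The order of two roots is the sign of a form in the remaining coordinates with
  coefficients at most \<open>2 * c^2\<close>, so it is preserved by the induction hypothesis.\<close>

lemma small_integer_solution:
  fixes v :: "nat \<Rightarrow> real"
  assumes "c \<ge> 1"
  shows "\<exists>u :: nat \<Rightarrow> int. (\<forall>j<k. \<bar>u j\<bar> \<le> int (height_bound k c)) \<and>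
    (\<forall>a :: nat \<Rightarrow> int. (\<forall>j<k. \<bar>a j\<bar> \<le> int c) \<longrightarrow>
      sgn (real_of_int (\<Sum>j<k. a j * u j)) = sgn (\<Sum>j<k. a j * v j))"
  using assms
proof (induction k arbitrary: c)
  case 0
  show ?case by simp
next
  case (Suc k)
  let ?g = "height_bound k (2 * c^2)"
  have c2: "c \<le> 2 * c^2" using Suc.prems by (simp add: power2_eq_square)
  then have "2 * c^2 \<ge> 1" using Suc.prems by simp
  from Suc.IH[OF this] obtain u :: "nat \<Rightarrow> int"
    where u: "\<forall>j<k. \<bar>u j\<bar> \<le> int ?g"
      and u_sgn: "\<And>a :: nat \<Rightarrow> int. (\<forall>j<k. \<bar>a j\<bar> \<le> int (2 * c^2)) \<Longrightarrow>
        sgn (real_of_int (\<Sum>j<k. a j * u j)) = sgn (\<Sum>j<k. a j * v j)"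
    by blast
  define A where "A = (\<lambda>a :: nat \<Rightarrow> int. real_of_int (\<Sum>j<k. a j * u j))"
  define B where "B = (\<lambda>a :: nat \<Rightarrow> int. \<Sum>j<k. a j * v j)"
  \<comment> \<open>Forms are set to 0 from \<open>k\<close> on, so that there are only finitely
    many of them as functions.\<close>
  define F where "F = {a :: nat \<Rightarrow> int. (\<forall>j. (j \<in> {..<k} \<longrightarrow> a j \<in> {- int c..int c})
      \<and> (j \<notin> {..<k} \<longrightarrow> a j = 0))}"
  \<comment> \<open>The pair \<open>(a, \<alpha>)\<close> stands for the form \<open>a\<close> in
    the old coordinates plus \<open>\<alpha>\<close> times the new one; \<open>\<rho>\<close> and
    \<open>\<rho>'\<close> give its root in the new coordinate, at the reals \<open>v\<close> and at
    the integers \<open>u\<close>.\<close>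
  define R where "R = F \<times> {0<..int c}"
  define \<rho> where "\<rho> = (\<lambda>(a, \<alpha>). - B a / real_of_int \<alpha>)"
  define \<rho>' where "\<rho>' = (\<lambda>(a, \<alpha>). - A a / real_of_int \<alpha>)"
  have "finite F" unfolding F_def by (rule finite_set_of_finite_funs) simp_all
  then have R_fin: "finite R" by (simp add: R_def)
  have "(\<lambda>_. 0, 1) \<in> R" using Suc.prems by (auto simp: R_def F_def)
  then have R_ne: "R \<noteq> {}" by blast
  have F: "\<bar>a j\<bar> \<le> int c" if "a \<in> F" "j < k" for a j
    using that by (auto simp: F_def abs_le_iff)
  have mono: "\<rho> r < \<rho> s \<longleftrightarrow> \<rho>' r < \<rho>' s" if rs: "r \<in> R" "s \<in> R" for r s
  proof -
    obtain a \<alpha> where r: "r = (a, \<alpha>)" "a \<in> F" "0 < \<alpha>" "\<alpha> \<le> int c" using rs by (auto simp: R_def)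
    obtain b \<beta> where s: "s = (b, \<beta>)" "b \<in> F" "0 < \<beta>" "\<beta> \<le> int c" using rs by (auto simp: R_def)
    let ?d = "\<lambda>j. \<beta> * a j - \<alpha> * b j"
    have "\<bar>?d j\<bar> \<le> int (2 * c^2)" if "j < k" for j
    proof -
      have "\<bar>\<beta> * a j\<bar> \<le> int c * int c" "\<bar>\<alpha> * b j\<bar> \<le> int c * int c"
        unfolding abs_mult using r s F that by (auto intro!: mult_mono)
      then show ?thesis by (simp add: power2_eq_square)
    qed
    then have "sgn (A ?d) = sgn (B ?d)" unfolding A_def B_def by (intro u_sgn) blast
    moreover have "A ?d = \<beta> * A a - \<alpha> * A b"
      by (simp add: A_def sum_distrib_left sum_subtractf algebra_simps)
    moreover have "B ?d = \<beta> * B a - \<alpha> * B b"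
      by (simp add: B_def sum_distrib_left sum_subtractf algebra_simps)
    ultimately have "\<alpha> * A b < \<beta> * A a \<longleftrightarrow> \<alpha> * B b < \<beta> * B a"
      by (auto simp: sgn_real_def split: if_splits)
    then show ?thesis using r s by (simp add: \<rho>_def \<rho>'_def field_simps)
  qed
  obtain l h and s :: int where lhs: "l \<in> R" "h \<in> R" "s \<in> {-1, 0, 1}"
    and sgn_lhs: "\<And>r. r \<in> R \<Longrightarrow> sgn ((\<rho>' l + \<rho>' h) / 2 + s - \<rho>' r) = sgn (v k - \<rho> r)"
    using sgn_eq_transfer[where \<rho> = \<rho> and \<rho>' = \<rho>' and v = "v k", OF R_fin R_ne mono] by blast
  obtain a \<alpha> where l: "l = (a, \<alpha>)" "a \<in> F" "0 < \<alpha>" "\<alpha> \<le> int c" using lhs by (auto simp: R_def)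
  obtain b \<beta> where h: "h = (b, \<beta>)" "b \<in> F" "0 < \<beta>" "\<beta> \<le> int c" using lhs by (auto simp: R_def)
  \<comment> \<open>A common denominator of \<open>(\<rho>' l + \<rho>' h) / 2 + s\<close>. The
    forms are homogeneous, so all coordinates may be multiplied by a positive number.\<close>
  define d where "d = 2 * \<alpha> * \<beta>"
  define y where "y = s * d - \<beta> * (\<Sum>j<k. a j * u j) - \<alpha> * (\<Sum>j<k. b j * u j)"
  have d: "d > 0" using l h by (simp add: d_def)
  have \<alpha>\<beta>: "\<alpha> * \<beta> \<le> int c * int c" using l h by (intro mult_mono) auto
  then have d_le: "d \<le> 2 * (int c)^2" by (simp add: d_def power2_eq_square)
  have y: "real_of_int y = d * ((\<rho>' l + \<rho>' h) / 2 + s)"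
    using l h by (simp add: y_def d_def \<rho>'_def A_def field_simps)
  define u' where "u' = (\<lambda>j. if j < k then d * u j else y)"
  have A: "\<bar>\<Sum>j<k. a j * u j\<bar> \<le> int k * int c * int ?g" "\<bar>\<Sum>j<k. b j * u j\<bar> \<le> int k * int c * int ?g"
    using F[OF l(2)] F[OF h(2)] u by (auto intro!: abs_linear_form_le)
  let ?q = "int k * int c * int ?g"
  have "\<bar>u' j\<bar> \<le> int (height_bound (Suc k) c)" if "j < Suc k" for j
  proof (cases "j < k")
    case True
    have "\<bar>u j\<bar> \<le> int ?g" using u True by blast
    also have "int ?g * 1 \<le> int ?g * (int k * int c)" 
      using True Suc.prems by (intro mult_left_mono) (auto simp flip: of_nat_mult)
    finally have "\<bar>u j\<bar> \<le> ?q + 1" by (simp add: algebra_simps)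
    then have "d * \<bar>u j\<bar> \<le> 2 * (int c)^2 * (?q + 1)"
      using d d_le by (intro mult_mono) auto
    then show ?thesis using True d by (simp add: u'_def abs_mult algebra_simps)
  next
    case False
    have "\<bar>s * d\<bar> \<le> d" using lhs(3) d by auto
    moreover have "\<bar>\<beta> * (\<Sum>j<k. a j * u j)\<bar> \<le> int c * ?q" "\<bar>\<alpha> * (\<Sum>j<k. b j * u j)\<bar> \<le> int c * ?q"
      unfolding abs_mult using A l h by (auto intro!: mult_mono)
    ultimately have "\<bar>y\<bar> \<le> d + 2 * (int c * ?q)" unfolding y_def by linarith
    also have "int c * ?q \<le> (int c * int c) * ?q"
      using Suc.prems by (intro mult_right_mono) (auto simp flip: of_nat_mult)
    finally have "\<bar>y\<bar> \<le> 2 * (int c)^2 * (?q + 1)"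
      using d_le by (simp add: power2_eq_square algebra_simps)
    then show ?thesis using False by (simp add: u'_def algebra_simps)
  qed
  moreover have "sgn (real_of_int (\<Sum>j<Suc k. f j * u' j)) = sgn (\<Sum>j<Suc k. f j * v j)"
    if f: "\<forall>j<Suc k. \<bar>f j\<bar> \<le> int c" for f :: "nat \<Rightarrow> int"
  proof -
    have u'_sum: "real_of_int (\<Sum>j<Suc k. f j * u' j) = d * A f + f k * y" for f :: "nat \<Rightarrow> int"
      by (simp add: A_def u'_def sum_distrib_left algebra_simps)
    \<comment> \<open>Divided by its positive last coefficient, a form is the signed distance of the
      new coordinate from one of the roots.\<close>
    have pos: "sgn (d * A f + f k * y) = sgn (B f + f k * v k)"
      if f: "\<forall>j<Suc k. \<bar>f j\<bar> \<le> int c" "f k > 0" for f :: "nat \<Rightarrow> int"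
    proof -
      define f' where "f' = (\<lambda>j. if j < k then f j else 0)"
      have f': "A f' = A f" "B f' = B f" by (simp_all add: A_def B_def f'_def)
      have "f' \<in> F" using f by (auto simp: F_def f'_def abs_le_iff less_Suc_eq)
      then have "(f', f k) \<in> R" using f by (auto simp: R_def abs_le_iff)
      from sgn_lhs[OF this]
      have *: "sgn ((\<rho>' l + \<rho>' h) / 2 + s + A f / f k) = sgn (v k + B f / f k)"
        by (simp add: \<rho>_def \<rho>'_def f')
      have "d * A f + f k * y = (real_of_int d * f k) * ((\<rho>' l + \<rho>' h) / 2 + s + A f / f k)"
        using f by (simp add: y field_simps)
      then have "sgn (d * A f + f k * y) = sgn ((\<rho>' l + \<rho>' h) / 2 + s + A f / f k)"
        using d f by (simp add: sgn_mult)
      also have "\<dots> = sgn (f k * (v k + B f / f k))" using * f by (simp add: sgn_mult)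
      also have "f k * (v k + B f / f k) = B f + f k * v k" using f by (simp add: field_simps)
      finally show ?thesis .
    qed
    have "sgn (d * A f + f k * y) = sgn (B f + f k * v k)"
    proof (cases "f k = 0")
      case True
      have "\<forall>j<k. \<bar>f j\<bar> \<le> int (2 * c^2)" using f c2 by (metis less_Suc_eq of_nat_mono order_trans)
      then have "sgn (A f) = sgn (B f)" unfolding A_def B_def by (rule u_sgn)
      then show ?thesis using True d by (simp add: sgn_mult)
    next
      case False
      show ?thesis
      proof (cases "f k > 0")
        case True
        then show ?thesis using pos f by blast
      next
        case neg: False
        \<comment> \<open>Roots were collected only for positive last coefficients; a negative one
          is reached by negating the whole form.\<close>
        let ?m = "\<lambda>j. - f j"
        have "sgn (d * A ?m + ?m k * y) = sgn (B ?m + ?m k * v k)"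
          using f neg False by (intro pos) auto
        moreover have "A ?m = - A f" "B ?m = - B f" by (simp_all add: A_def B_def sum_negf)
        ultimately have "sgn (- (d * A f + f k * y)) = sgn (- (B f + f k * v k))" by simp
        then show ?thesis unfolding sgn_minus by simp
      qed
    qed
    then show ?thesis unfolding u'_sum by (simp add: B_def)
  qed
  ultimately show ?case by blast
qed


section \<open>Coding finite functions and lists\<close>

definition digit :: "nat \<Rightarrow> nat \<Rightarrow> nat \<Rightarrow> nat" where
  "digit b c i = c div b ^ i mod b"

lemma digit_less: "b > 0 \<Longrightarrow> digit b c i < b"
  by (simp add: digit_def)

text \<open>Horner's scheme gives the witness. Thus \<open>\<exists>c<b ^ n\<close> ranges over all
  functions from \<open>{..<n}\<close> to \<open>{..<b}\<close>, and bounded quantifiers can speak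
  of tables and assignments.\<close>

lemma ex_digits:
  assumes "\<And>i. i < n \<Longrightarrow> f i < b"
  shows "\<exists>c<b ^ n. \<forall>i<n. digit b c i = f i"
  using assms
proof (induction n arbitrary: f)
  case (Suc n)
  from Suc.IH[of "\<lambda>i. f (Suc i)"] Suc.prems
  obtain c where c: "c < b ^ n" "\<forall>i<n. digit b c i = f (Suc i)" by auto
  have f0: "f 0 < b" using Suc.prems by simp
  have "f 0 + b * c < b * (c + 1)" using f0 by simp
  also have "\<dots> \<le> b * b ^ n" using c(1) by (intro mult_left_mono) auto
  finally have "f 0 + b * c < b ^ Suc n" by simp
  moreover have "digit b (f 0 + b * c) i = f i" if "i < Suc n" for i
  proof (cases i)
    case 0
    then show ?thesis using f0 by (simp add: digit_def)
  next
    case (Suc j)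
    have "(f 0 + b * c) div b ^ Suc j = c div b ^ j"
      using f0 by (simp add: div_mult2_eq)
    then show ?thesis using c(2) that Suc by (simp add: digit_def)
  qed
  ultimately show ?case by blast
qed simp

lemma recursive_digit:
  "recursive f \<Longrightarrow> recursive g \<Longrightarrow> recursive h \<Longrightarrow> recursive (\<lambda>x. digit (f x) (g x) (h x))"
  unfolding digit_def by (intro recursive_intros)

section \<open>Coded lists and integers\<close>

lemma add_le_prod_encode: "a + b \<le> prod_encode (a, b)"
proof -
  have "n \<le> triangle n" for n by (induction n) simp_all
  from this[of "a + b"] show ?thesis by (simp add: prod_encode_def)
qed

lemma pfst_le: "pfst n \<le> n" and psnd_le: "psnd n \<le> n"
  using add_le_prod_encode[of "pfst n" "psnd n"] by (simp_all add: prod_encode_pfst_psnd)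

text \<open>In \<open>list_encode\<close> the empty list is 0 and a nonempty list is the successor
  of a pair, hence \<open>s - 1\<close>. Dropping beyond the end stays at 0, so
  \<open>code_drop i s \<noteq> 0\<close> says that position \<open>i\<close> exists.\<close>

definition code_hd :: "nat \<Rightarrow> nat" where "code_hd s = pfst (s - 1)"
definition code_tl :: "nat \<Rightarrow> nat" where "code_tl s = psnd (s - 1)"
definition code_drop :: "nat \<Rightarrow> nat \<Rightarrow> nat" where "code_drop i s = (code_tl ^^ i) s"
definition code_nth :: "nat \<Rightarrow> nat \<Rightarrow> nat" where "code_nth s i = code_hd (code_drop i s)"

lemma code_tl_list_encode: "code_tl (list_encode xs) = list_encode (tl xs)"
  using psnd_le[of 0] by (cases xs) (simp_all add: code_tl_def)

lemma code_drop_list_encode: "code_drop i (list_encode xs) = list_encode (drop i xs)"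
  by (induction i) (simp_all add: code_drop_def code_tl_list_encode drop_Suc tl_drop)

lemma code_nth_list_encode: "i < length xs \<Longrightarrow> code_nth (list_encode xs) i = xs ! i"
  by (simp add: code_nth_def code_drop_list_encode Cons_nth_drop_Suc[symmetric] code_hd_def)

lemma list_encode_eq_0_iff: "list_encode xs = 0 \<longleftrightarrow> xs = []"
  by (cases xs) simp_all

lemma code_drop_eq_0_iff: "code_drop i (list_encode xs) = 0 \<longleftrightarrow> length xs \<le> i"
  by (simp add: code_drop_list_encode list_encode_eq_0_iff)

lemma length_le_list_encode: "length xs \<le> list_encode xs"
proof (induction xs)
  case (Cons x xs)
  then show ?case using le_prod_encode_2[of "list_encode xs" x] by simp
qed simp

lemma member_le_list_encode: "x \<in> set xs \<Longrightarrow> x \<le> list_encode xs"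
proof (induction xs)
  case (Cons y xs)
  then show ?case
    using le_prod_encode_2[of "list_encode xs" y] le_prod_encode_1[of y "list_encode xs"]
    by fastforce
qed simp

lemma recursive_code_drop:
  assumes "recursive f" "recursive g"
  shows "recursive (\<lambda>x. code_drop (f x) (g x))"
proof -
  have "recursive code_tl" unfolding code_tl_def by (intro recursive_intros)
  then show ?thesis unfolding code_drop_def using assms by (intro recursive_funpow)
qed

lemma recursive_code_nth:
  "recursive f \<Longrightarrow> recursive g \<Longrightarrow> recursive (\<lambda>x. code_nth (f x) (g x))"
  unfolding code_nth_def code_hd_def by (intro recursive_intros recursive_code_drop)

text \<open>A list is no longer than its code, so the code itself bounds the positions.\<close>

definition all_list :: "nat \<Rightarrow> (nat \<Rightarrow> bool) \<Rightarrow> bool" where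
  "all_list s P \<longleftrightarrow> (\<forall>i\<le>s. code_drop i s \<noteq> 0 \<longrightarrow> P (code_nth s i))"

lemma all_list_encode: "all_list (list_encode xs) P \<longleftrightarrow> (\<forall>x\<in>set xs. P x)"
proof -
  have "all_list (list_encode xs) P \<longleftrightarrow> (\<forall>i<length xs. P (xs ! i))"
    unfolding all_list_def code_drop_eq_0_iff using length_le_list_encode[of xs]
    by (auto simp: code_nth_list_encode not_le)
  then show ?thesis by (simp add: all_set_conv_all_nth)
qed

lemma decidable_all_list:
  assumes "recursive s" "decidable (\<lambda>z. P (pfst z) (psnd z))"
  shows "decidable (\<lambda>x. all_list (s x) (\<lambda>y. P y x))"
  unfolding all_list_def
  by (intro recursive_intros recursive_code_drop recursive_code_nth decidable_comp[OF assms(2)]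
      recursive_comp[OF assms(1)])

lemma prod_encode_mono:
  assumes "a \<le> a'" "b \<le> b'"
  shows "prod_encode (a, b) \<le> prod_encode (a', b')"
  using triangle_mono[of "a + b" "a' + b'"] assms by (simp add: prod_encode_def)

text \<open>\<open>int_encode\<close> gives nonnegative integers even codes and negative ones odd
  codes. Splitting a numerator into two natural numbers avoids subtraction in
  \<open>values_ok\<close>.\<close>

definition int_pos :: "nat \<Rightarrow> nat" where
  "int_pos i = (if i mod 2 = 0 then i div 2 else 0)"
definition int_neg :: "nat \<Rightarrow> nat" where
  "int_neg i = (if i mod 2 = 0 then 0 else i div 2 + 1)"

lemma int_pos_neg_encode: "int (int_pos (int_encode z)) - int (int_neg (int_encode z)) = z"
  by (simp add: int_encode_def sum_encode_def int_pos_def int_neg_def)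

lemma int_pos_neg_le: "int_pos i \<le> i" "int_neg i \<le> i"
  unfolding int_pos_def int_neg_def by presburger+


section \<open>The decision procedure\<close>

text \<open>Throughout, \<open>e\<close> is the code of the clause list; it bounds all names and codes that occur in it.

  A base-sort variable takes values below \<open>pos_base e\<close>; the possible values of ground terms are the
  multiples \<open>gap e * m\<close> with \<open>1 \<le> m \<le> max_value e\<close>, and between two of them there is room for
  all variables of a clause. Finite functions are coded by their digits: \<open>V\<close> maps codes of ground
  terms to the numbers \<open>m\<close>, \<open>\<kappa>\<close> maps names of free-sort elements to elements, \<open>\<beta>\<close> and \<open>\<gamma>\<close> are
  assignments, and \<open>T\<close> is a truth table of instances of atoms.\<close>

definition coeff_bound :: "nat \<Rightarrow> nat" where
  "coeff_bound e = (e + 1) * ((e + 1) * fact e)"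
text \<open>A ground term is a linear form in \<open>e + 2\<close> coordinates with coefficients at
  most \<open>coeff_bound e\<close>. The coordinates are taken for the doubled bound because they
  must decide the signs of differences of two such forms.\<close>

definition value_bound :: "nat \<Rightarrow> nat" where
  "value_bound e = (e + 2) * coeff_bound e * height_bound (e + 2) (2 * coeff_bound e)"
text \<open>Makes all values positive. Positions below \<open>gap e\<close> then form the cell to
  the left of all special points.\<close>

definition offset :: "nat \<Rightarrow> nat" where "offset e = value_bound e + 1"
definition max_value :: "nat \<Rightarrow> nat" where "max_value e = 2 * value_bound e + 2"
definition gap :: "nat \<Rightarrow> nat" where "gap e = e + 2"
definition pos_base :: "nat \<Rightarrow> nat" where "pos_base e = gap e * (max_value e + 1)"

definition term_value :: "nat \<Rightarrow> nat \<Rightarrow> nat \<Rightarrow> nat" where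
  "term_value e V n = digit (max_value e + 1) V n"

text \<open>The digits of \<open>V\<close> are the values of the ground terms when a rational \<open>q\<close> is read as
  \<open>q * fact e * u\<close>, increased by \<open>offset e\<close>. A denominator \<open>d\<close> is coded as \<open>2 * d\<close>.\<close>

definition values_ok :: "nat \<Rightarrow> nat \<Rightarrow> nat \<Rightarrow> bool" where
  "values_ok e u V \<longleftrightarrow> (\<forall>n\<le>e. 0 < term_value e V n \<and>
     (pfst n = 0 \<longrightarrow>
        term_value e V n + int_neg (pfst (psnd n)) * (fact e div (psnd (psnd n) div 2)) * u
        = offset e + int_pos (pfst (psnd n)) * (fact e div (psnd (psnd n) div 2)) * u) \<and>
     (pfst n = 3 \<longrightarrow> term_value e V n + offset e
        = term_value e V (pfst (psnd n)) + term_value e V (psnd (psnd n))) \<and>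
     (pfst n = 4 \<longrightarrow> term_value e V n + term_value e V (psnd (psnd n))
        = term_value e V (pfst (psnd n)) + offset e))"

definition base_value :: "nat \<Rightarrow> nat \<Rightarrow> nat \<Rightarrow> nat" where
  "base_value e \<beta> x = digit (pos_base e) \<beta> x"

definition position :: "nat \<Rightarrow> nat \<Rightarrow> nat \<Rightarrow> nat \<Rightarrow> nat" where
  "position e V \<beta> n =
     (if pfst n = 1 then base_value e \<beta> (psnd n) else gap e * term_value e V n)"

text \<open>A variable is assigned a name, which then passes through \<open>\<kappa>\<close> as
  constants do. Equality in the model becomes equality of representatives.\<close>

definition element :: "nat \<Rightarrow> nat \<Rightarrow> nat \<Rightarrow> nat \<Rightarrow> nat" where
  "element e \<kappa> \<gamma> t =
     digit (e + 1) \<kappa> (if pfst t = 0 then digit (e + 1) \<gamma> (psnd t) else psnd t)"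

definition comparison_true :: "nat \<Rightarrow> nat \<Rightarrow> nat \<Rightarrow> bool" where
  "comparison_true r x y \<longleftrightarrow> (if r = 0 then x < y else if r = 1 then x \<le> y else if r = 2 then x = y
     else if r = 3 then x \<noteq> y else if r = 4 then y \<le> x else y < x)"

definition la_true :: "nat \<Rightarrow> nat \<Rightarrow> nat \<Rightarrow> nat \<Rightarrow> bool" where
  "la_true e V \<beta> a \<longleftrightarrow> comparison_true (pfst a)
     (position e V \<beta> (pfst (psnd a))) (position e V \<beta> (psnd (psnd a)))"

text \<open>Truth values are indexed by an atom together with the assignments, so types of tuples
  need not be enumerated; agreement between instances of the same type is demanded separately
  through \<open>similar\<close>.\<close>

definition table :: "nat \<Rightarrow> nat \<Rightarrow> nat \<Rightarrow> nat \<Rightarrow> bool" where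
  "table T \<beta> \<gamma> a \<longleftrightarrow> digit 2 T (prod_encode (a, prod_encode (\<beta>, \<gamma>))) = 1"

definition free_true :: "nat \<Rightarrow> nat \<Rightarrow> nat \<Rightarrow> nat \<Rightarrow> nat \<Rightarrow> nat \<Rightarrow> bool" where
  "free_true e \<kappa> T \<beta> \<gamma> a \<longleftrightarrow>
     (if pfst a = 0 then element e \<kappa> \<gamma> (pfst (psnd a)) = element e \<kappa> \<gamma> (psnd (psnd a))
      else table T \<beta> \<gamma> a)"

definition clause_true :: "nat \<Rightarrow> nat \<Rightarrow> nat \<Rightarrow> nat \<Rightarrow> nat \<Rightarrow> nat \<Rightarrow> nat \<Rightarrow> bool" where
  "clause_true e V \<kappa> T \<beta> \<gamma> c \<longleftrightarrow>
     all_list (pfst c) (\<lambda>a. la_true e V \<beta> a) \<and>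
     all_list (pfst (psnd c)) (\<lambda>a. free_true e \<kappa> T \<beta> \<gamma> a) \<longrightarrow>
     \<not> all_list (psnd (psnd c)) (\<lambda>a. \<not> free_true e \<kappa> T \<beta> \<gamma> a)"

text \<open>The two orders may differ, so a real can be compared with a position. The index 0 is
  left out since values of terms are shifted to be positive.\<close>

definition same_cell ::
    "nat \<Rightarrow> (nat \<Rightarrow> 'a::linorder) \<Rightarrow> (nat \<Rightarrow> 'b::linorder) \<Rightarrow> 'a \<Rightarrow> 'b \<Rightarrow> bool" where
  "same_cell M p q x y \<longleftrightarrow>
     (\<forall>m\<le>M. 0 < m \<longrightarrow> (x < p m \<longleftrightarrow> y < q m) \<and> (p m < x \<longleftrightarrow> q m < y))"

text \<open>The relation \<open>same_type\<close> below, spelled out for coded argument lists with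
  all quantifiers bounded.\<close>

definition similar_args ::
    "nat \<Rightarrow> nat \<Rightarrow> nat \<Rightarrow> nat \<Rightarrow> nat \<Rightarrow> nat \<Rightarrow> nat \<Rightarrow> nat \<Rightarrow> bool" where
  "similar_args e \<kappa> \<beta> \<gamma> l \<beta>' \<gamma>' l' \<longleftrightarrow>
     (\<forall>i\<le>e. (code_drop i l = 0 \<longleftrightarrow> code_drop i l' = 0) \<and>
       (code_drop i l \<noteq> 0 \<longrightarrow>
         (pfst (code_nth l i) = 0 \<longleftrightarrow> pfst (code_nth l' i) = 0) \<and>
         (if pfst (code_nth l i) = 0
          then same_cell (max_value e) (\<lambda>m. gap e * m) (\<lambda>m. gap e * m)
                 (base_value e \<beta> (psnd (code_nth l i))) (base_value e \<beta>' (psnd (code_nth l' i)))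
          else element e \<kappa> \<gamma> (psnd (code_nth l i)) = element e \<kappa> \<gamma>' (psnd (code_nth l' i))) \<and>
         (\<forall>j\<le>e. code_drop j l \<noteq> 0 \<and> pfst (code_nth l i) = 0 \<and> pfst (code_nth l j) = 0 \<longrightarrow>
           (base_value e \<beta> (psnd (code_nth l i)) < base_value e \<beta> (psnd (code_nth l j)) \<longleftrightarrow>
            base_value e \<beta>' (psnd (code_nth l' i)) < base_value e \<beta>' (psnd (code_nth l' j))))))"

definition similar ::
    "nat \<Rightarrow> nat \<Rightarrow> nat \<Rightarrow> nat \<Rightarrow> nat \<Rightarrow> nat \<Rightarrow> nat \<Rightarrow> nat \<Rightarrow> bool" where
  "similar e \<kappa> \<beta> \<gamma> a \<beta>' \<gamma>' a' \<longleftrightarrow>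
     pfst a = 1 \<and> pfst a' = 1 \<and> pfst (psnd a) = pfst (psnd a') \<and>
     similar_args e \<kappa> \<beta> \<gamma> (psnd (psnd a)) \<beta>' \<gamma>' (psnd (psnd a'))"

definition table_size :: "nat \<Rightarrow> nat" where
  "table_size e =
     Suc (prod_encode (e, prod_encode (pos_base e ^ (e + 1), (e + 1) ^ (e + 1))))"

text \<open>The number \<open>u\<close> stands for \<open>1 / fact e\<close>. The last conjunct lets
  the table be read as relations: instances whose argument tuples have the same type agree, even if
  they come from different atoms of a predicate.\<close>

definition has_uniform_model :: "nat \<Rightarrow> bool" where
  "has_uniform_model e \<longleftrightarrow>
     (\<exists>u\<le>max_value e. 0 < u \<and> (\<exists>V<(max_value e + 1) ^ (e + 1). values_ok e u V \<and>
     (\<exists>\<kappa><(e + 1) ^ (e + 1). \<exists>T<2 ^ table_size e.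
     (\<forall>\<beta><pos_base e ^ (e + 1). \<forall>\<gamma><(e + 1) ^ (e + 1).
        all_list e (\<lambda>c. clause_true e V \<kappa> T \<beta> \<gamma> c) \<and>
        (\<forall>a\<le>e. \<forall>\<beta>'<pos_base e ^ (e + 1). \<forall>\<gamma>'<(e + 1) ^ (e + 1). \<forall>a'\<le>e.
           similar e \<kappa> \<beta> \<gamma> a \<beta>' \<gamma>' a' \<longrightarrow> (table T \<beta> \<gamma> a \<longleftrightarrow> table T \<beta>' \<gamma>' a'))))))"

section \<open>Decidability of the criterion\<close>

lemma recursive_parameters:
  assumes "recursive f"
  shows "recursive (\<lambda>x. coeff_bound (f x))" "recursive (\<lambda>x. value_bound (f x))"
    "recursive (\<lambda>x. offset (f x))" "recursive (\<lambda>x. max_value (f x))" "recursive (\<lambda>x. gap (f x))"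
    "recursive (\<lambda>x. pos_base (f x))" "recursive (\<lambda>x. table_size (f x))"
  unfolding table_size_def pos_base_def gap_def max_value_def offset_def value_bound_def
    coeff_bound_def
  by (intro recursive_intros recursive_height_bound assms)+

lemma recursive_values:
  assumes "recursive f" "recursive g" "recursive h"
  shows "recursive (\<lambda>x. term_value (f x) (g x) (h x))"
    "recursive (\<lambda>x. base_value (f x) (g x) (h x))"
  unfolding term_value_def base_value_def
  by (intro recursive_intros recursive_digit recursive_parameters assms)+

lemma recursive_position_element:
  assumes "recursive f" "recursive g" "recursive h" "recursive k"
  shows "recursive (\<lambda>x. position (f x) (g x) (h x) (k x))"
    "recursive (\<lambda>x. element (f x) (g x) (h x) (k x))"
  unfolding position_def element_def
  by (intro recursive_intros recursive_digit recursive_parameters recursive_values assms)+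

lemma decidable_table:
  assumes "recursive f" "recursive g" "recursive h" "recursive k"
  shows "decidable (\<lambda>x. table (f x) (g x) (h x) (k x))"
  unfolding table_def by (intro recursive_intros recursive_digit assms)

lemma decidable_la_true:
  assumes "recursive f" "recursive g" "recursive h" "recursive k"
  shows "decidable (\<lambda>x. la_true (f x) (g x) (h x) (k x))"
  unfolding la_true_def comparison_true_def
  by (intro recursive_intros recursive_position_element assms)

lemma decidable_free_true:
  assumes "recursive f" "recursive g" "recursive h" "recursive k" "recursive l" "recursive m"
  shows "decidable (\<lambda>x. free_true (f x) (g x) (h x) (k x) (l x) (m x))"
  unfolding free_true_def
  by (intro recursive_intros recursive_position_element decidable_table assms)

lemma decidable_values_ok:
  assumes "recursive f" "recursive g" "recursive h"
  shows "decidable (\<lambda>x. values_ok (f x) (g x) (h x))"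
  unfolding values_ok_def int_neg_def int_pos_def
  by (intro recursive_intros recursive_values recursive_parameters assms[THEN recursive_comp])

lemma decidable_clause_true:
  assumes "recursive f" "recursive g" "recursive h" "recursive k" "recursive l" "recursive m"
    "recursive n"
  shows "decidable (\<lambda>x. clause_true (f x) (g x) (h x) (k x) (l x) (m x) (n x))"
  unfolding clause_true_def
  by (intro recursive_intros decidable_all_list decidable_la_true decidable_free_true
      assms[THEN recursive_comp])

lemma decidable_similar:
  assumes "recursive f" "recursive g" "recursive h" "recursive k" "recursive l" "recursive m"
    "recursive n" "recursive o'"
  shows "decidable (\<lambda>x. similar (f x) (g x) (h x) (k x) (l x) (m x) (n x) (o' x))"
  unfolding similar_def similar_args_def same_cell_def
  by (intro recursive_intros recursive_code_drop recursive_code_nth recursive_values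
      recursive_position_element recursive_parameters assms[THEN recursive_comp])

lemma decidable_has_uniform_model: "decidable has_uniform_model"
proof -
  have "decidable (\<lambda>e. has_uniform_model e)"
    unfolding has_uniform_model_def
    by (intro recursive_intros decidable_values_ok decidable_all_list decidable_clause_true
        decidable_similar decidable_table recursive_parameters)
  then show ?thesis .
qed


section \<open>Types of tuples\<close>

text \<open>Only strict comparisons are recorded: in a linear order they also determine which
  base-sort entries are equal.\<close>

definition same_type ::
    "nat \<Rightarrow> (nat \<Rightarrow> 'a::linorder) \<Rightarrow> (nat \<Rightarrow> 'b::linorder) \<Rightarrow> ('a + 'c) list \<Rightarrow> ('b + 'c) list \<Rightarrow> bool"
  where
  "same_type M p q xs ys \<longleftrightarrow> length xs = length ys \<and>
     (\<forall>i<length xs. (isl (xs ! i) \<longleftrightarrow> isl (ys ! i)) \<and>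
       (if isl (xs ! i) then same_cell M p q (projl (xs ! i)) (projl (ys ! i))
        else projr (xs ! i) = projr (ys ! i)) \<and>
       (\<forall>j<length xs. isl (xs ! i) \<and> isl (xs ! j) \<longrightarrow>
         (projl (xs ! i) < projl (xs ! j) \<longleftrightarrow> projl (ys ! i) < projl (ys ! j))))"

lemma same_type_common:
  assumes "same_type M p q xs ys" "same_type M p r xs zs"
  shows "same_type M q r ys zs"
  unfolding same_type_def
proof (intro conjI allI impI)
  have len: "length ys = length xs" "length zs = length xs"
    using assms by (simp_all add: same_type_def)
  then show "length ys = length zs" by simp
  have cell: "same_cell M q r y z" if "same_cell M p q x y" "same_cell M p r x z" for x y z
    using that by (simp add: same_cell_def)
  have y: "isl (ys ! i) \<longleftrightarrow> isl (xs ! i)" "isl (zs ! i) \<longleftrightarrow> isl (xs ! i)"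
    "isl (xs ! i) \<Longrightarrow> same_cell M p q (projl (xs ! i)) (projl (ys ! i))"
    "isl (xs ! i) \<Longrightarrow> same_cell M p r (projl (xs ! i)) (projl (zs ! i))"
    "\<not> isl (xs ! i) \<Longrightarrow> projr (ys ! i) = projr (xs ! i)"
    "\<not> isl (xs ! i) \<Longrightarrow> projr (zs ! i) = projr (xs ! i)" if "i < length xs" for i
    using assms that by (fastforce simp: same_type_def)+
  have less: "projl (ys ! i) < projl (ys ! j) \<longleftrightarrow> projl (xs ! i) < projl (xs ! j)"
    "projl (zs ! i) < projl (zs ! j) \<longleftrightarrow> projl (xs ! i) < projl (xs ! j)"
    if "i < length xs" "j < length xs" "isl (xs ! i)" "isl (xs ! j)" for i j
    using assms that by (simp_all add: same_type_def)
  fix i assume i: "i < length ys"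
  then show "isl (ys ! i) \<longleftrightarrow> isl (zs ! i)" using y len by simp
  show "if isl (ys ! i) then same_cell M q r (projl (ys ! i)) (projl (zs ! i))
      else projr (ys ! i) = projr (zs ! i)"
    using i y[of i] cell len by auto
  fix j assume "j < length ys" "isl (ys ! i) \<and> isl (ys ! j)"
  then show "projl (ys ! i) < projl (ys ! j) \<longleftrightarrow> projl (zs ! i) < projl (zs ! j)"
    using i less y(1) len by simp
qed

definition arg_value :: "nat \<Rightarrow> nat \<Rightarrow> nat \<Rightarrow> nat \<Rightarrow> nat \<Rightarrow> nat + nat" where
  "arg_value e \<kappa> \<beta> \<gamma> x =
     (if pfst x = 0 then Inl (base_value e \<beta> (psnd x)) else Inr (element e \<kappa> \<gamma> (psnd x)))"

definition tuple :: "nat \<Rightarrow> nat \<Rightarrow> nat \<Rightarrow> nat \<Rightarrow> nat \<Rightarrow> (nat + nat) list" where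
  "tuple e \<kappa> \<beta> \<gamma> l = map (arg_value e \<kappa> \<beta> \<gamma>) (list_decode l)"

lemma similar_args_iff:
  assumes "l \<le> e" "l' \<le> e"
  shows "similar_args e \<kappa> \<beta> \<gamma> l \<beta>' \<gamma>' l' \<longleftrightarrow>
    same_type (max_value e) (\<lambda>m. gap e * m) (\<lambda>m. gap e * m) (tuple e \<kappa> \<beta> \<gamma> l) (tuple e \<kappa> \<beta>' \<gamma>' l')"
proof -
  define xs where "xs = list_decode l"
  define ys where "ys = list_decode l'"
  have l: "l = list_encode xs" "l' = list_encode ys" by (simp_all add: xs_def ys_def)
  have len: "length xs \<le> e" "length ys \<le> e"
    using assms length_le_list_encode[of xs] length_le_list_encode[of ys] by (simp_all add: l)
  have eq: "(\<forall>i\<le>e. (length xs \<le> i \<longleftrightarrow> length ys \<le> i) \<and> (\<not> length xs \<le> i \<longrightarrow> P i)) \<longleftrightarrow>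
      length xs = length ys \<and> (\<forall>i<length xs. P i)" for P
    using len by (metis le_antisym le_refl less_imp_le not_le order_trans)
  have all: "(\<forall>j\<le>e. \<not> length xs \<le> j \<and> A \<and> P j \<longrightarrow> Q j) \<longleftrightarrow> (\<forall>j<length xs. A \<and> P j \<longrightarrow> Q j)" for A P Q
    using len by auto
  have arg: "isl (arg_value e \<kappa> \<beta> \<gamma> x) \<longleftrightarrow> pfst x = 0"
    "pfst x = 0 \<Longrightarrow> projl (arg_value e \<kappa> \<beta> \<gamma> x) = base_value e \<beta> (psnd x)"
    "pfst x \<noteq> 0 \<Longrightarrow> projr (arg_value e \<kappa> \<beta> \<gamma> x) = element e \<kappa> \<gamma> (psnd x)" for \<beta> \<gamma> x
    by (simp_all add: arg_value_def)
  note unfold = similar_args_def l code_drop_eq_0_iff eq all same_type_def tuple_def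
    list_encode_inverse length_map
  \<comment> \<open>If lengths or sorts disagree, both sides are false. Otherwise corresponding
    entries lie in the same summand and the two formulas coincide.\<close>
  show ?thesis
  proof (cases "length xs = length ys \<and> (\<forall>i<length ys. pfst (xs ! i) = 0 \<longleftrightarrow> pfst (ys ! i) = 0)")
    case True
    then show ?thesis unfolding unfold
      by (simp add: code_nth_list_encode arg cong: conj_cong imp_cong if_cong)
  next
    case False
    then show ?thesis unfolding unfold
      by (auto simp: code_nth_list_encode arg(1) cong: conj_cong)
  qed
qed

text \<open>A value equal to a special point goes to the corresponding multiple of \<open>g\<close>.
  Any other value is placed behind the last special point below it, or behind 0, at distance one
  plus its rank among the variables \<open>0..e\<close>. The rank is at most \<open>e\<close>, so
  the distance is less than \<open>e + 2\<close> and stays inside the cell.\<close>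

lemma ex_positions:
  fixes p :: "nat \<Rightarrow> 'a::linorder"
  assumes p: "strict_mono p" and g: "g \<ge> e + 2"
  shows "\<exists>f. (\<forall>x\<le>e. f x < g * (M + 1)) \<and>
    (\<forall>x\<le>e. same_cell M p (\<lambda>m. g * m) (\<beta> x) (f x)) \<and>
    (\<forall>x\<le>e. \<forall>y\<le>e. \<beta> x < \<beta> y \<longleftrightarrow> f x < f y)"
proof -
  define c where "c = (\<lambda>x. card {m \<in> {1..M}. p m \<le> \<beta> x})"
  define r where "r = (\<lambda>x. card {y. y \<le> e \<and> \<beta> y < \<beta> x})"
  define S where "S = (\<lambda>x. \<exists>m\<in>{1..M}. \<beta> x = p m)"
  define f where "f = (\<lambda>x. g * c x + (if S x then 0 else 1 + r x))"
  have p_less: "p m < p n \<longleftrightarrow> m < n" and p_le: "p m \<le> p n \<longleftrightarrow> m \<le> n" for m n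
    using p by (simp_all add: strict_mono_less strict_mono_less_eq)
  have c: "p m \<le> \<beta> x \<longleftrightarrow> m \<le> c x" if m: "1 \<le> m" "m \<le> M" for m x
  proof
    assume "p m \<le> \<beta> x"
    then have "{1..m} \<subseteq> {m \<in> {1..M}. p m \<le> \<beta> x}" using m p_le order_trans[OF _ \<open>p m \<le> \<beta> x\<close>] by auto
    from card_mono[OF _ this] show "m \<le> c x" by (simp add: c_def)
  next
    assume *: "m \<le> c x"
    show "p m \<le> \<beta> x"
    proof (rule ccontr)
      assume "\<not> p m \<le> \<beta> x"
      then have "n < m" if "p n \<le> \<beta> x" for n
        using le_less_trans[OF that, of "p m"] p_less by (simp add: not_le)
      then have "{m \<in> {1..M}. p m \<le> \<beta> x} \<subseteq> {1..<m}" by auto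
      from card_mono[OF _ this] * m show False by (simp add: c_def)
    qed
  qed
  have c_le: "c x \<le> M" for x
  proof -
    have "{m \<in> {1..M}. p m \<le> \<beta> x} \<subseteq> {1..M}" by blast
    from card_mono[OF _ this] show ?thesis by (simp add: c_def)
  qed
  have r_le: "r x \<le> e" if "x \<le> e" for x
  proof -
    have "{y. y \<le> e \<and> \<beta> y < \<beta> x} \<subseteq> {..e} - {x}" by auto
    from card_mono[OF _ this] that show ?thesis by (simp add: r_def)
  qed
  have r_mono: "r x < r y" if "x \<le> e" "\<beta> x < \<beta> y" for x y
    unfolding r_def using that by (intro psubset_card_mono) auto
  have S: "1 \<le> c x" "\<beta> x = p (c x)" if Sx: "S x" for x
  proof -
    obtain m where m: "1 \<le> m" "m \<le> M" "\<beta> x = p m" using Sx by (auto simp: S_def)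
    have "m \<le> c x" using c[of m x] m by simp
    moreover have "c x \<le> m"
      using c[of "c x" x] c_le[of x] m p_le[of "c x" m] \<open>m \<le> c x\<close> by simp
    ultimately show "1 \<le> c x" "\<beta> x = p (c x)" using m by simp_all
  qed
  have f_div: "g * c x \<le> f x \<and> f x < g * (c x + 1)" if "x \<le> e" for x
    using r_le[OF that] g by (simp add: f_def)
  have f_less: "f x < g * m \<longleftrightarrow> c x < m" if "x \<le> e" for x m
  proof
    assume "f x < g * m"
    then have "g * c x < g * m" using f_div[OF that] by linarith
    then show "c x < m" by simp
  next
    assume "c x < m"
    then have "g * (c x + 1) \<le> g * m" by (intro mult_left_mono) auto
    then show "f x < g * m" using f_div[OF that] by linarith
  qed
  have "same_cell M p (\<lambda>m. g * m) (\<beta> x) (f x)" if x: "x \<le> e" for x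
    unfolding same_cell_def
  proof (intro allI impI conjI)
    fix m assume m: "m \<le> M" "0 < m"
    have cm: "p m \<le> \<beta> x \<longleftrightarrow> m \<le> c x" using c[of m x] m by simp
    show "\<beta> x < p m \<longleftrightarrow> f x < g * m"
      unfolding f_less[OF x] using cm by (meson not_le)
    show "p m < \<beta> x \<longleftrightarrow> g * m < f x"
    proof (cases "S x")
      case True
      have "p m < \<beta> x \<longleftrightarrow> m < c x" by (subst S(2)[OF True]) (rule p_less)
      then show ?thesis using True g by (simp add: f_def)
    next
      case False
      have "\<beta> x \<noteq> p m" using False m by (auto simp: S_def)
      then have "p m < \<beta> x \<longleftrightarrow> m \<le> c x" unfolding cm[symmetric] less_le by auto
      also have "\<dots> \<longleftrightarrow> g * m < f x"
      proof
        assume "m \<le> c x"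
        then have "g * m \<le> g * c x" by simp
        moreover have "f x = g * c x + 1 + r x" using False by (simp add: f_def)
        ultimately show "g * m < f x" by linarith
      next
        assume "g * m < f x"
        then show "m \<le> c x" using f_less[OF x, of m] by simp
      qed
      finally show ?thesis .
    qed
  qed
  moreover have less: "f x < f y" if xy: "x \<le> e" "y \<le> e" "\<beta> x < \<beta> y" for x y
  proof (cases "c x = c y")
    case False
    have "c x \<le> c y" unfolding c_def using xy by (intro card_mono) auto
    then have "f x < g * c y" using False f_less[OF xy(1)] by simp
    then show ?thesis using f_div[OF xy(2)] by linarith
  next
    case True
    \<comment> \<open>If \<open>\<beta> y\<close> were the special point \<open>p (c y)\<close>,
      equal indices would put \<open>\<beta> x\<close> at or above it.\<close>
    have "\<not> S y"
    proof
      assume "S y"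
      then have "1 \<le> c y" "p (c y) = \<beta> y" using S by auto
      then have "p (c y) \<le> \<beta> x" using c[of "c x" x] c_le[of x] True by simp
      then show False using \<open>p (c y) = \<beta> y\<close> xy by simp
    qed
    then show ?thesis using True r_mono[OF xy(1,3)] by (simp add: f_def)
  qed
  moreover have "f x = f y" if "\<beta> x = \<beta> y" for x y
    using that by (simp add: f_def c_def r_def S_def)
  ultimately have "\<forall>x\<le>e. \<forall>y\<le>e. \<beta> x < \<beta> y \<longleftrightarrow> f x < f y"
    by (metis linorder_less_linear order_less_asym order_less_irrefl)
  moreover have "f x < g * (M + 1)" if "x \<le> e" for x
    using f_less[OF that, of "M + 1"] c_le[of x] by simp
  ultimately show ?thesis
    using \<open>\<And>x. x \<le> e \<Longrightarrow> same_cell M p (\<lambda>m. g * m) (\<beta> x) (f x)\<close> by blast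
qed

lemma comparison_true_encode:
  fixes a b :: real
  assumes "a < b \<longleftrightarrow> x < y" "b < a \<longleftrightarrow> y < x"
  shows "comparison_true (encode_comparison r) x y \<longleftrightarrow> compare r a b"
  using assms by (cases r) (auto simp: comparison_true_def)

lemma prod_encode_leD:
  "prod_encode (a, b) \<le> e \<Longrightarrow> a \<le> e \<and> b \<le> e"
  using le_prod_encode_1[of a b] le_prod_encode_2[of b a] by linarith

lemma encode_components_le:
  assumes "(ls, gs, ds) \<in> set w"
  shows "a \<in> set ls \<Longrightarrow> encode_la_atom a \<le> encode w"
    "a' \<in> set gs \<union> set ds \<Longrightarrow> encode_free_atom a' \<le> encode w"
proof -
  have *: "encode_clause (ls, gs, ds) \<le> encode w"
    unfolding encode_def by (rule member_le_list_encode) (use assms in \<open>auto intro: rev_image_eqI\<close>)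
  have "list_encode (map encode_la_atom ls) \<le> encode w"
    and "list_encode (map encode_free_atom gs) \<le> encode w"
    and "list_encode (map encode_free_atom ds) \<le> encode w"
    using * by (auto dest: prod_encode_leD)
  then show "a \<in> set ls \<Longrightarrow> encode_la_atom a \<le> encode w"
    "a' \<in> set gs \<union> set ds \<Longrightarrow> encode_free_atom a' \<le> encode w"
    by (force intro: order_trans[OF member_le_list_encode])+
qed

lemma clause_true_encode:
  "clause_true e V \<kappa> T \<beta> \<gamma> (encode_clause (ls, gs, ds)) \<longleftrightarrow>
    ((\<forall>a\<in>set ls. la_true e V \<beta> (encode_la_atom a)) \<and>
     (\<forall>a\<in>set gs. free_true e \<kappa> T \<beta> \<gamma> (encode_free_atom a)) \<longrightarrow>
     (\<exists>a\<in>set ds. free_true e \<kappa> T \<beta> \<gamma> (encode_free_atom a)))"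
  by (simp add: clause_true_def all_list_encode)

lemma pfst_encode_ground: "ground t \<Longrightarrow> pfst (encode_la_term t) \<noteq> 1"
  by (cases t) simp_all

primrec element_sum :: "'s element \<Rightarrow> real + 's" where
  "element_sum (Real r) = Inl r"
| "element_sum (Elem s) = Inr s"


section \<open>From a table to a model\<close>

text \<open>The map \<open>p\<close> undoes shift and scaling, which turns the equations of
  \<open>values_ok\<close> into the laws of term evaluation. Skolem constants simply receive the
  value prescribed by \<open>V\<close>.\<close>

lemma values_ok_la_value:
  assumes V: "values_ok e u V" and u: "u > 0"
    and p: "p = (\<lambda>m. (real m - real (offset e)) / (fact e * real u))"
    and sk: "\<And>c. skolem_value A c = p (term_value e V (prod_encode (2, c)))"
  shows "ground t \<Longrightarrow> encode_la_term t \<le> e \<Longrightarrow>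
    la_value A \<beta> t = p (term_value e V (encode_la_term t))"
proof (induction t)
  case (Rational q)
  obtain a b where ab: "quotient_of q = (a, b)" by fastforce
  have b: "b > 0" using quotient_of_denom_pos[OF ab] .
  let ?i = "int_encode a" and ?n = "encode_la_term (Rational q)"
  have code: "?n = prod_encode (0, prod_encode (?i, int_encode b))"
    by (simp add: encode_rat_def ab)
  have ib: "int_encode b = 2 * nat b" using b by (simp add: int_encode_def sum_encode_def)
  have "nat b \<le> e" using Rational.prems prod_encode_leD unfolding code ib
    by (metis le_add1 mult_2 order_trans)
  \<comment> \<open>A denominator is part of the code of its rational, so it is at most
    \<open>e\<close> and divides \<open>fact e\<close>.\<close>
  then have "nat b dvd fact e" using b by (intro dvd_fact) auto
  then obtain k where k: "fact e = nat b * k" by blast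
  have fe: "(fact e :: real) = real (nat b * k)" using k by (metis of_nat_fact)
  have "k > 0" using k by (metis fact_nonzero gr0I mult_0_right)
  have "fact e div nat b = k" using k b by simp
  then have "term_value e V ?n + int_neg ?i * k * u = offset e + int_pos ?i * k * u"
    using V Rational.prems(2) unfolding values_ok_def code ib by fastforce
  then have "real (term_value e V ?n) - real (offset e) = (real (int_pos ?i) - real (int_neg ?i)) * k * u"
    unfolding of_nat_eq_iff[where 'a = real, symmetric] by (simp add: algebra_simps)
  moreover have "real (int_pos ?i) - real (int_neg ?i) = real_of_int a"
    using int_pos_neg_encode[of a] by (metis of_int_diff of_int_of_nat_eq)
  ultimately have "p (term_value e V ?n) = real_of_int a * k * u / (fact e * u)"
    by (simp add: p)
  also have "\<dots> = a / b" using b u \<open>k > 0\<close> by (simp add: fe)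
  also have "\<dots> = of_rat q" using quotient_of_div[OF ab] by (simp add: of_rat_divide)
  finally show ?case by simp
next
  case (Skolem c)
  then show ?case by (simp add: sk)
next
  case (Plus s t)
  have le: "encode_la_term s \<le> e" "encode_la_term t \<le> e"
    using Plus.prems by (auto dest: prod_encode_leD)
  have "term_value e V (encode_la_term (Plus s t)) + offset e
      = term_value e V (encode_la_term s) + term_value e V (encode_la_term t)"
    using V Plus.prems unfolding values_ok_def by fastforce
  then have "real (term_value e V (encode_la_term (Plus s t))) - real (offset e)
      = (real (term_value e V (encode_la_term s)) - real (offset e))
        + (real (term_value e V (encode_la_term t)) - real (offset e))"
    unfolding of_nat_eq_iff[where 'a = real, symmetric] of_nat_add by linarith
  then have "p (term_value e V (encode_la_term (Plus s t)))
      = p (term_value e V (encode_la_term s)) + p (term_value e V (encode_la_term t))"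
    by (simp only: p add_divide_distrib[symmetric])
  then show ?case using Plus le by simp
next
  case (Minus s t)
  have le: "encode_la_term s \<le> e" "encode_la_term t \<le> e"
    using Minus.prems by (auto dest: prod_encode_leD)
  have "term_value e V (encode_la_term (Minus s t)) + term_value e V (encode_la_term t)
      = term_value e V (encode_la_term s) + offset e"
    using V Minus.prems unfolding values_ok_def by fastforce
  then have "real (term_value e V (encode_la_term (Minus s t))) - real (offset e)
      = (real (term_value e V (encode_la_term s)) - real (offset e))
        - (real (term_value e V (encode_la_term t)) - real (offset e))"
    unfolding of_nat_eq_iff[where 'a = real, symmetric] of_nat_add by linarith
  then have "p (term_value e V (encode_la_term (Minus s t)))
      = p (term_value e V (encode_la_term s)) - p (term_value e V (encode_la_term t))"
    by (simp only: p diff_divide_distrib[symmetric])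
  then show ?case using Minus le by simp
qed simp

text \<open>A well-sorted tuple belongs to a relation iff it has the type of some true instance in
  the table. To check a clause, a real assignment is rounded to positions, where the table already
  satisfies the clause.\<close>

lemma has_uniform_model_satisfiable:
  assumes N: "finite_bsr_slr_clause_set \<Sigma> N" and w: "presents w N"
    and model: "has_uniform_model (encode w)"
  shows "satisfiable TYPE(nat) \<Sigma> N"
proof -
  define e where "e = encode w"
  define B where "B = pos_base e ^ (e + 1)"
  define G where "G = (e + 1) ^ (e + 1)"
  from model obtain u V \<kappa> T where u: "u > 0" and V: "values_ok e u V"
    and all: "\<forall>\<beta><B. \<forall>\<gamma><G. all_list e (\<lambda>c. clause_true e V \<kappa> T \<beta> \<gamma> c) \<and>
        (\<forall>a\<le>e. \<forall>\<beta>'<B. \<forall>\<gamma>'<G. \<forall>a'\<le>e.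
           similar e \<kappa> \<beta> \<gamma> a \<beta>' \<gamma>' a' \<longrightarrow> (table T \<beta> \<gamma> a \<longleftrightarrow> table T \<beta>' \<gamma>' a'))"
    unfolding has_uniform_model_def e_def[symmetric] B_def[symmetric] G_def[symmetric] by blast
  let ?M = "max_value e" and ?q = "\<lambda>m. gap e * m"
  define p where "p = (\<lambda>m. (real m - real (offset e)) / (fact e * real u))"
  have p: "strict_mono p" using u by (intro strict_monoI) (simp add: p_def divide_strict_right_mono)
  define U where "U = digit (e + 1) \<kappa> ` {..e}"
  define dom where "dom = (\<lambda>\<xi>. case \<xi> of Base \<Rightarrow> range Real | Free \<Rightarrow> Elem ` U)"
  \<comment> \<open>Constants of the signature may have names above \<open>e\<close>;
    \<open>min c e\<close> keeps their values in the universe. The first conjunct on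
    \<open>vs\<close> confines the relations to well-sorted tuples.\<close>
  define A where "A = \<lparr>universe = U,
    skolem_value = (\<lambda>c. p (term_value e V (prod_encode (2, c)))),
    constant_value = (\<lambda>c. digit (e + 1) \<kappa> (min c e)),
    relation = (\<lambda>P. {vs. (\<forall>\<xi>s. predicates \<Sigma> P = Some \<xi>s \<longrightarrow> list_all2 (\<lambda>v \<xi>. v \<in> dom \<xi>) vs \<xi>s) \<and>
      (\<exists>a\<le>e. \<exists>\<beta><B. \<exists>\<gamma><G. pfst a = 1 \<and> pfst (psnd a) = P \<and> table T \<beta> \<gamma> a \<and>
        same_type ?M p ?q (map element_sum vs) (tuple e \<kappa> \<beta> \<gamma> (psnd (psnd a))))})\<rparr>"
  have dom: "sort_domain A \<xi> = dom \<xi>" for \<xi> by (cases \<xi>) (simp_all add: A_def dom_def)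
  have rel: "vs \<in> relation A P \<longleftrightarrow>
      (\<forall>\<xi>s. predicates \<Sigma> P = Some \<xi>s \<longrightarrow> list_all2 (\<lambda>v \<xi>. v \<in> dom \<xi>) vs \<xi>s) \<and>
      (\<exists>a\<le>e. \<exists>\<beta><B. \<exists>\<gamma><G. pfst a = 1 \<and> pfst (psnd a) = P \<and> table T \<beta> \<gamma> a \<and>
        same_type ?M p ?q (map element_sum vs) (tuple e \<kappa> \<beta> \<gamma> (psnd (psnd a))))" for vs P
    by (simp add: A_def)
  have "is_interpretation \<Sigma> A"
    unfolding is_interpretation_def dom by (auto simp: A_def U_def)
  moreover have "models_clause A C" if "C \<in> N" for C
    unfolding models_clause_def
  proof (intro allI impI, elim conjE)
    fix \<beta> :: "nat \<Rightarrow> real" and \<gamma> :: "nat \<Rightarrow> nat"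
    assume \<gamma>: "range \<gamma> \<subseteq> universe A"
      and la: "\<forall>a\<in>#constraint C. holds_la A \<beta> a"
      and ante: "\<forall>a\<in>#antecedent C. holds_free A \<beta> \<gamma> a"
    obtain ls gs ds where C: "C = Clause (mset ls) (mset gs) (mset ds)" "(ls, gs, ds) \<in> set w"
      using \<open>C \<in> N\<close> w by (auto simp: presents_def)
    have wf: "\<forall>a\<in>set ls. slr_atom a" "\<forall>a\<in>set gs \<union> set ds. wf_free_atom \<Sigma> a"
      using N \<open>C \<in> N\<close> C by (auto simp: finite_bsr_slr_clause_set_def bsr_slr_clause_def)
    note le = encode_components_le[OF C(2), folded e_def]
    obtain f where f: "\<forall>x\<le>e. f x < pos_base e" "\<forall>x\<le>e. same_cell ?M p ?q (\<beta> x) (f x)"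
      "\<forall>x\<le>e. \<forall>y\<le>e. \<beta> x < \<beta> y \<longleftrightarrow> f x < f y"
      using ex_positions[OF p, of e "gap e" ?M \<beta>] unfolding pos_base_def gap_def by auto
    obtain b where b: "b < B" "\<forall>x<e+1. digit (pos_base e) b x = f x"
      using ex_digits[of "e + 1" f "pos_base e"] f(1) by (auto simp: B_def)
    have bv: "base_value e b x = f x" if "x \<le> e" for x using b that by (simp add: base_value_def)
    have "\<forall>x. \<exists>n\<le>e. \<gamma> x = digit (e + 1) \<kappa> n" using \<gamma> by (force simp: A_def U_def)
    then obtain h where h: "\<And>x. h x \<le> e" "\<And>x. \<gamma> x = digit (e + 1) \<kappa> (h x)" by metis
    obtain g where g: "g < G" "\<forall>x<e+1. digit (e + 1) g x = h x"
      using ex_digits[of "e + 1" h "e + 1"] h(1) by (auto simp: G_def less_Suc_eq_le)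
    have el: "element e \<kappa> g (encode_free_term t) = free_value A \<gamma> t"
      if "encode_free_term t \<le> e" for t
      using that g h by (cases t) (auto simp: element_def A_def dest!: prod_encode_leD)
    \<comment> \<open>These are the indices that \<open>same_cell\<close> compares, so the cell of a
      variable decides its comparison with a ground term.\<close>
    have tv: "0 < term_value e V n" "term_value e V n \<le> ?M" if "n \<le> e" for n
      using V that digit_less[of "?M + 1" V n] by (auto simp: values_ok_def term_value_def)
    have sk: "skolem_value A c = p (term_value e V (prod_encode (2, c)))" for c
      by (simp add: A_def)
    have ground_value: "la_value A \<beta> t = p (term_value e V (encode_la_term t))"
      "position e V b (encode_la_term t) = gap e * term_value e V (encode_la_term t)"
      if "ground t" "encode_la_term t \<le> e" for t
      using values_ok_la_value[OF V u p_def sk that] pfst_encode_ground[OF that(1)]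
      by (simp_all add: position_def)
    have var_value: "la_value A \<beta> (BaseVar x) = \<beta> x" "position e V b (encode_la_term (BaseVar x)) = f x"
      if "x \<le> e" for x using bv that by (simp_all add: position_def)
    have "gap e > 0" by (simp add: gap_def)
    have pos: "la_value A \<beta> s < la_value A \<beta> t
        \<longleftrightarrow> position e V b (encode_la_term s) < position e V b (encode_la_term t)"
      if s: "ground s \<or> is_base_var s" "encode_la_term s \<le> e"
        and t: "ground t \<or> is_base_var t" "encode_la_term t \<le> e" for s t
    proof -
      have x: "x \<le> e" if "encode_la_term (BaseVar x) \<le> e" for x
        using that by (auto dest: prod_encode_leD)
      consider "ground s" "ground t" | y where "ground s" "t = BaseVar y"
        | x where "s = BaseVar x" "ground t" | x y where "s = BaseVar x" "t = BaseVar y"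
        using s t by (auto simp: is_base_var_def)
      then show ?thesis
      proof cases
        case 1
        then show ?thesis
          using ground_value s t strict_mono_less[OF p] \<open>gap e > 0\<close> by simp
      next
        case 2
        then show ?thesis
          using ground_value(1)[OF 2(1) s(2)] ground_value(2)[OF 2(1) s(2)] var_value[of y] x[of y]
            f(2) s t tv[OF s(2)] by (simp add: same_cell_def)
      next
        case 3
        then show ?thesis
          using ground_value(1)[OF 3(2) t(2)] ground_value(2)[OF 3(2) t(2)] var_value[of x] x[of x]
            f(2) s t tv[OF t(2)] by (simp add: same_cell_def)
      next
        case 4
        then show ?thesis using var_value x[of x] x[of y] f(3) s t by simp
      qed
    qed
    have la': "la_true e V b (encode_la_atom a)" if a: "a \<in> set ls" for a
    proof -
      obtain r s t where rst: "a = Compare r s t" by (cases a)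
      have st: "ground s \<or> is_base_var s" "ground t \<or> is_base_var t"
        using wf(1) a rst by auto
      have st_le: "encode_la_term s \<le> e" "encode_la_term t \<le> e"
        using le(1)[OF a] rst by (auto dest!: prod_encode_leD)
      have "holds_la A \<beta> a" using la a C by simp
      then show ?thesis
        using comparison_true_encode[OF pos[OF st(1) st_le(1) st(2) st_le(2)]
            pos[OF st(2) st_le(2) st(1) st_le(1)], of r]
        by (simp add: la_true_def rst)
    qed
    have free: "free_true e \<kappa> T b g (encode_free_atom a) \<longleftrightarrow> holds_free A \<beta> \<gamma> a"
      if a: "a \<in> set gs \<union> set ds" for a
    proof (cases a)
      case (Eq s t)
      then have "encode_free_term s \<le> e" "encode_free_term t \<le> e"
        using le(2)[OF a] by (auto dest!: prod_encode_leD)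
      then show ?thesis using el by (simp add: free_true_def Eq)
    next
      case (Pred P args)
      let ?vs = "map (argument_value A \<beta> \<gamma>) args"
      let ?l = "list_encode (map encode_argument args)"
      let ?a = "encode_free_atom a"
      have a_eq: "?a = prod_encode (1, prod_encode (P, ?l))" by (simp add: Pred)
      have a_le: "?a \<le> e" using le(2)[OF a] .
      then have l_le: "?l \<le> e" unfolding a_eq by (blast dest: prod_encode_leD)
      have args_le: "encode_argument x \<le> e" if "x \<in> set args" for x
        using member_le_list_encode[of "encode_argument x" "map encode_argument args"] that l_le
        by auto
      have arg: "(\<exists>y. x = BaseArg y \<and> y \<le> e \<and> argument_value A \<beta> \<gamma> x = Real (\<beta> y) \<and>
            arg_value e \<kappa> b g (encode_argument x) = Inl (f y)) \<or>
          (\<exists>t. argument_value A \<beta> \<gamma> x = Elem t \<and> arg_value e \<kappa> b g (encode_argument x) = Inr t)"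
        if "x \<in> set args" for x
        using args_le[OF that] el bv by (cases x) (auto simp: arg_value_def dest!: prod_encode_leD)
      have type: "same_type ?M p ?q (map element_sum ?vs) (tuple e \<kappa> b g ?l)"
        unfolding same_type_def tuple_def list_encode_inverse length_map
      proof (intro conjI allI impI)
        fix i assume i: "i < length args"
        then have ia: "args ! i \<in> set args" by simp
        show "isl (map element_sum ?vs ! i) =
            isl (map (arg_value e \<kappa> b g) (map encode_argument args) ! i)"
          using arg[OF ia] i by auto
        show "if isl (map element_sum ?vs ! i)
          then same_cell ?M p ?q (projl (map element_sum ?vs ! i))
            (projl (map (arg_value e \<kappa> b g) (map encode_argument args) ! i))
          else projr (map element_sum ?vs ! i)
            = projr (map (arg_value e \<kappa> b g) (map encode_argument args) ! i)"
          using arg[OF ia] i f(2) by auto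
        fix j assume j: "j < length args"
          and l: "isl (map element_sum ?vs ! i) \<and> isl (map element_sum ?vs ! j)"
        then have ja: "args ! j \<in> set args" by simp
        show "(projl (map element_sum ?vs ! i) < projl (map element_sum ?vs ! j)) =
          (projl (map (arg_value e \<kappa> b g) (map encode_argument args) ! i)
            < projl (map (arg_value e \<kappa> b g) (map encode_argument args) ! j))"
          using arg[OF ia] arg[OF ja] i j l f(3) by auto
      qed simp
      have sorted: "list_all2 (\<lambda>v \<xi>. v \<in> dom \<xi>) ?vs \<xi>s" if "predicates \<Sigma> P = Some \<xi>s" for \<xi>s
      proof -
        have "list_all2 (wf_argument \<Sigma>) args \<xi>s" using wf(2)[rule_format, OF a] that Pred by simp
        moreover have "free_value A \<gamma> t \<in> U" for t
          using \<gamma> by (cases t) (auto simp: A_def U_def)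
        then have "argument_value A \<beta> \<gamma> x \<in> dom \<xi>" if "wf_argument \<Sigma> x \<xi>" for x \<xi>
          using that by (cases x) (auto simp: dom_def)
        ultimately show ?thesis
          unfolding list.rel_map by (rule list_all2_mono)
      qed
      have "?vs \<in> relation A P \<longleftrightarrow> table T b g ?a"
      proof
        assume "table T b g ?a"
        moreover have "pfst ?a = 1" "pfst (psnd ?a) = P" "psnd (psnd ?a) = ?l" by (simp_all add: a_eq)
        ultimately show "?vs \<in> relation A P"
          unfolding rel using sorted type a_le b(1) g(1) by metis
      next
        assume "?vs \<in> relation A P"
        \<comment> \<open>The witnessing instance may be another atom under other assignments. It
          has the type of the same real tuple as the present instance, so uniformity of the table
          makes the two agree.\<close>
        then obtain a' \<beta>' \<gamma>' where *: "a' \<le> e" "\<beta>' < B" "\<gamma>' < G" "pfst a' = 1" "pfst (psnd a') = P"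
          "table T \<beta>' \<gamma>' a'"
          "same_type ?M p ?q (map element_sum ?vs) (tuple e \<kappa> \<beta>' \<gamma>' (psnd (psnd a')))"
          unfolding rel by blast
        have "psnd (psnd a') \<le> e" using psnd_le *(1) by (meson order_trans)
        from similar_args_iff[OF this l_le] same_type_common[OF *(7) type]
        have "similar e \<kappa> \<beta>' \<gamma>' a' b g ?a" using * by (simp add: similar_def a_eq)
        then show "table T b g ?a" using all * b(1) g(1) a_le by blast
      qed
      then show ?thesis by (simp add: free_true_def Pred)
    qed
    have "all_list e (\<lambda>c. clause_true e V \<kappa> T b g c)" using all b(1) g(1) by blast
    then have "clause_true e V \<kappa> T b g (encode_clause (ls, gs, ds))"
      unfolding e_def encode_def all_list_encode using C(2) by auto
    moreover have "\<forall>a\<in>set gs. free_true e \<kappa> T b g (encode_free_atom a)"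
      using ante free C by auto
    ultimately obtain a where "a \<in> set ds" "free_true e \<kappa> T b g (encode_free_atom a)"
      using la' unfolding clause_true_encode by blast
    then show "\<exists>a\<in>#succedent C. holds_free A \<beta> \<gamma> a" using free C by auto
  qed
  ultimately show ?thesis unfolding satisfiable_def by blast
qed


section \<open>Integer values of ground terms\<close>

text \<open>The coefficients of the value of a coded ground term as a linear form: coordinate \<open>0\<close> stands for
  \<open>1 / F\<close>, coordinate \<open>c + 1\<close> for the Skolem constant \<open>c\<close>.\<close>

lemma code_arguments_less: "0 < pfst n \<Longrightarrow> pfst (psnd n) < n" "0 < pfst n \<Longrightarrow> psnd (psnd n) < n"
  using add_le_prod_encode[of "pfst n" "psnd n"] pfst_le[of "psnd n"] psnd_le[of "psnd n"]
  by (simp_all add: prod_encode_pfst_psnd)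

function coeff :: "nat \<Rightarrow> nat \<Rightarrow> nat \<Rightarrow> int" where
  "coeff F n j =
     (if pfst n = 0 then
        (if j = 0 then (int (int_pos (pfst (psnd n))) - int (int_neg (pfst (psnd n))))
           * int (F div (psnd (psnd n) div 2)) else 0)
      else if pfst n = 2 then (if j = psnd n + 1 then 1 else 0)
      else if pfst n = 3 then coeff F (pfst (psnd n)) j + coeff F (psnd (psnd n)) j
      else if pfst n = 4 then coeff F (pfst (psnd n)) j - coeff F (psnd (psnd n)) j
      else 0)"
  by auto
termination
  by (relation "measure (\<lambda>(F, n, j). n)") (auto intro: code_arguments_less)

declare coeff.simps [simp del]

text \<open>Codes are superadditive: the codes \<open>s\<close>, \<open>t\<close> of two arguments
  satisfy \<open>s + t + 1 \<le> n\<close>, so the bounds \<open>s + 1\<close> and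
  \<open>t + 1\<close> add up to at most \<open>n + 1\<close>. The factor \<open>(e + 1) * F\<close>
  bounds the coefficient of a rational.\<close>

lemma abs_coeff_le:
  assumes "n \<le> e" "F > 0"
  shows "\<bar>coeff F n j\<bar> \<le> int (n + 1) * int ((e + 1) * F)"
  using assms(1)
proof (induction n rule: less_induct)
  case (less n)
  let ?L = "int ((e + 1) * F)"
  have L: "?L \<ge> 1" using assms(2) by (metis One_nat_def Suc_leI add_gr_0 nat_0_less_mult_iff of_nat_1 of_nat_mono zero_less_one)
  consider "pfst n = 0" | "pfst n = 2" | "pfst n = 3 \<or> pfst n = 4" | "pfst n \<notin> {0, 2, 3, 4}" by auto
  then show ?case
  proof cases
    case 1
    let ?i = "pfst (psnd n)"
    have "?i \<le> e" using pfst_le psnd_le less.prems by (meson order_trans)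
    then have "\<bar>int (int_pos ?i) - int (int_neg ?i)\<bar> \<le> int (e + 1)"
      using int_pos_neg_le[of ?i] by linarith
    then have "\<bar>int (int_pos ?i) - int (int_neg ?i)\<bar> * int (F div (psnd (psnd n) div 2))
        \<le> int (e + 1) * int F"
      by (intro mult_mono) simp_all
    also have "\<dots> \<le> int (n + 1) * ?L" using L by (simp add: algebra_simps)
    finally show ?thesis using 1 by (subst coeff.simps) (auto simp: abs_mult)
  next
    case 2
    have "1 * 1 \<le> int (n + 1) * ?L" using L by (intro mult_mono) auto
    then show ?thesis using 2 by (subst coeff.simps) auto
  next
    case 3
    let ?s = "pfst (psnd n)" and ?t = "psnd (psnd n)"
    have lt: "?s < n" "?t < n" using code_arguments_less 3 by auto
    have st: "?s + ?t + 1 \<le> n"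
      using add_le_prod_encode[of "pfst n" "psnd n"] add_le_prod_encode[of ?s ?t] 3
      by (auto simp: prod_encode_pfst_psnd)
    have "\<bar>coeff F ?s j\<bar> \<le> int (?s + 1) * ?L" "\<bar>coeff F ?t j\<bar> \<le> int (?t + 1) * ?L"
      using less.IH lt less.prems by auto
    moreover have "\<bar>coeff F n j\<bar> \<le> \<bar>coeff F ?s j\<bar> + \<bar>coeff F ?t j\<bar>"
      using 3 by (subst coeff.simps) auto
    ultimately have "\<bar>coeff F n j\<bar> \<le> int (?s + 1 + (?t + 1)) * ?L"
      by (simp add: algebra_simps)
    also have "\<dots> \<le> int (n + 1) * ?L" using st L by (intro mult_right_mono) auto
    finally show ?thesis .
  next
    case 4
    then show ?thesis using L by (subst coeff.simps) simp
  qed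
qed

text \<open>With \<open>1 / fact e\<close> as coordinate 0, a rational \<open>a / b\<close> with
  \<open>b \<le> e\<close> gets the integer coefficient \<open>a * (fact e div b)\<close>. Skolem
  constants with names up to \<open>e\<close> fill the coordinates 1 to
  \<open>e + 1\<close>.\<close>

lemma la_value_ground:
  fixes v :: "nat \<Rightarrow> real"
  assumes v0: "v 0 = 1 / fact e" and v: "\<And>c. v (Suc c) = skolem_value A c"
  shows "ground t \<Longrightarrow> encode_la_term t \<le> e \<Longrightarrow>
    la_value A \<beta> t = (\<Sum>j<e + 2. coeff (fact e) (encode_la_term t) j * v j)"
proof (induction t)
  case (Rational q)
  obtain a b where ab: "quotient_of q = (a, b)" by fastforce
  have b: "b > 0" using quotient_of_denom_pos[OF ab] .
  let ?n = "encode_la_term (Rational q)"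
  have code: "?n = prod_encode (0, prod_encode (int_encode a, int_encode b))"
    by (simp add: encode_rat_def ab)
  have ib: "int_encode b = 2 * nat b" using b by (simp add: int_encode_def sum_encode_def)
  have "nat b \<le> e" using Rational.prems prod_encode_leD unfolding code ib
    by (metis le_add1 mult_2 order_trans)
  then have "nat b dvd fact e" using b by (intro dvd_fact) auto
  then obtain k where k: "fact e = nat b * k" by blast
  have fe: "(fact e :: real) = real (nat b * k)" using k by (metis of_nat_fact)
  have "k > 0" using k by (metis fact_nonzero gr0I mult_0_right)
  have "fact e div nat b = k" using k b by simp
  then have "coeff (fact e) ?n j = (if j = 0 then a * int k else 0)" for j
    unfolding code ib by (subst coeff.simps) (simp add: int_pos_neg_encode)
  then have "(\<Sum>j<e + 2. coeff (fact e) ?n j * v j) = (\<Sum>j<e + 2. if j = 0 then a * int k * v j else 0)"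
    by (intro sum.cong) auto
  also have "\<dots> = a * int k * v 0" by (subst sum.delta) auto
  also have "\<dots> = a / b" using b \<open>k > 0\<close> by (simp add: v0 fe)
  also have "\<dots> = of_rat q" using quotient_of_div[OF ab] by (simp add: of_rat_divide)
  finally show ?case by simp
next
  case (Skolem c)
  let ?n = "encode_la_term (Skolem c)"
  have "c \<le> e" using Skolem.prems by (auto dest: prod_encode_leD)
  have "coeff (fact e) ?n j = (if j = Suc c then 1 else 0)" for j
    by (subst coeff.simps) simp
  then have "(\<Sum>j<e + 2. coeff (fact e) ?n j * v j) = (\<Sum>j<e + 2. if j = Suc c then v j else 0)"
    by (intro sum.cong) auto
  also have "\<dots> = skolem_value A c" using \<open>c \<le> e\<close> v by (subst sum.delta) auto
  finally show ?case by simp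
next
  case (Plus s t)
  then have le: "encode_la_term s \<le> e" "encode_la_term t \<le> e" by (auto dest!: prod_encode_leD)
  have "coeff (fact e) (encode_la_term (Plus s t)) j
      = coeff (fact e) (encode_la_term s) j + coeff (fact e) (encode_la_term t) j" for j
    by (subst coeff.simps) simp
  then show ?case using Plus le
    by (simp add: distrib_right sum.distrib del: encode_la_term.simps sum.lessThan_Suc)
next
  case (Minus s t)
  then have le: "encode_la_term s \<le> e" "encode_la_term t \<le> e" by (auto dest!: prod_encode_leD)
  have "coeff (fact e) (encode_la_term (Minus s t)) j
      = coeff (fact e) (encode_la_term s) j - coeff (fact e) (encode_la_term t) j" for j
    by (subst coeff.simps) simp
  then show ?case using Minus le
    by (simp add: left_diff_distrib sum_subtractf del: encode_la_term.simps sum.lessThan_Suc)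
qed simp

text \<open>The reals to be imitated are \<open>1 / fact e\<close> and the Skolem values of
  \<open>A\<close>. A small integer solution preserves the sign of the difference of any two ground
  terms, hence their order. Codes of no ground term are evaluated by the same linear forms, so they
  obey the equations too.\<close>

lemma ex_term_values:
  "\<exists>u V. 0 < u \<and> u \<le> max_value e \<and> V < (max_value e + 1) ^ (e + 1) \<and> values_ok e u V \<and>
    (\<forall>s t \<beta>. ground s \<and> ground t \<and> encode_la_term s \<le> e \<and> encode_la_term t \<le> e \<longrightarrow>
      (la_value A \<beta> s < la_value A \<beta> t \<longleftrightarrow>
       term_value e V (encode_la_term s) < term_value e V (encode_la_term t)))"
proof -
  let ?F = "fact e :: nat" and ?c = "coeff_bound e"
  define v where "v = (\<lambda>j. case j of 0 \<Rightarrow> 1 / fact e | Suc c \<Rightarrow> skolem_value A c)"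
  have v: "v 0 = 1 / fact e" "\<And>c. v (Suc c) = skolem_value A c" by (simp_all add: v_def)
  have F: "?F \<ge> 1" by (rule fact_ge_1)
  then have "1 * (1 * 1) \<le> (e + 1) * ((e + 1) * ?F)" by (intro mult_le_mono) auto
  then have c: "?c \<ge> 1" by (simp add: coeff_bound_def)
  let ?g = "height_bound (e + 2) (2 * ?c)"
  obtain u :: "nat \<Rightarrow> int" where u: "\<forall>j<e + 2. \<bar>u j\<bar> \<le> int ?g"
    and sgn: "\<And>a :: nat \<Rightarrow> int. (\<forall>j<e + 2. \<bar>a j\<bar> \<le> int (2 * ?c)) \<Longrightarrow>
      sgn (real_of_int (\<Sum>j<e + 2. a j * u j)) = sgn (\<Sum>j<e + 2. a j * v j)"
    using small_integer_solution[of "2 * ?c" "e + 2" v] c by auto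
  define val where "val = (\<lambda>n. \<Sum>j<e + 2. coeff ?F n j * u j)"
  define valv where "valv = (\<lambda>n. \<Sum>j<e + 2. coeff ?F n j * v j)"
  have coeff_le: "\<bar>coeff ?F n j\<bar> \<le> int ?c" if "n \<le> e" for n j
  proof -
    have "\<bar>coeff ?F n j\<bar> \<le> int (n + 1) * int ((e + 1) * ?F)"
      using abs_coeff_le[OF that, of ?F] F by simp
    also have "\<dots> \<le> int (e + 1) * int ((e + 1) * ?F)"
      using that by (intro mult_right_mono) auto
    finally show ?thesis unfolding coeff_bound_def of_nat_mult .
  qed
  have val_le: "\<bar>val n\<bar> \<le> int (value_bound e)" if "n \<le> e" for n
    unfolding val_def value_bound_def of_nat_mult
    by (rule abs_linear_form_le[OF _ u]) (use coeff_le[OF that] in simp_all)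
  have val_less: "val n < val m \<longleftrightarrow> valv n < valv m" if "n \<le> e" "m \<le> e" for n m
  proof -
    let ?a = "\<lambda>j. coeff ?F n j - coeff ?F m j"
    have "\<forall>j<e + 2. \<bar>?a j\<bar> \<le> int (2 * ?c)"
    proof (intro allI impI)
      fix j
      show "\<bar>?a j\<bar> \<le> int (2 * ?c)" using coeff_le[OF that(1), of j] coeff_le[OF that(2), of j] by simp
    qed
    from sgn[OF this] have "sgn (real_of_int (val n - val m)) = sgn (valv n - valv m)"
      by (simp add: val_def valv_def left_diff_distrib sum_subtractf del: sum.lessThan_Suc)
    then show ?thesis by (auto simp: sgn_real_def split: if_splits)
  qed
  have sum0: "(\<Sum>j<e + 2. (if j = 0 then a else 0) * w j) = a * w 0"
    for a :: "'b :: comm_ring_1" and w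
  proof -
    have "(\<Sum>j<e + 2. (if j = 0 then a else 0) * w j) = (\<Sum>j<e + 2. if j = 0 then a * w j else 0)"
      by (intro sum.cong) auto
    then show ?thesis by (subst (asm) sum.delta) auto
  qed
  \<comment> \<open>The form selecting coordinate 0 is among those whose sign is preserved, so the
    integer in place of \<open>1 / fact e\<close> is positive.\<close>
  have "sgn (real_of_int (\<Sum>j<e + 2. (if j = 0 then 1 else 0) * u j))
      = sgn (\<Sum>j<e + 2. real_of_int (if j = 0 then 1 else 0) * v j)"
    using c by (intro sgn) auto
  then have "sgn (real_of_int (u 0)) = sgn (v 0)"
    unfolding if_distrib[of real_of_int] of_int_0 of_int_1 sum0 by simp
  then have u0: "u 0 > 0" by (simp add: v sgn_real_def split: if_splits)
  have "u 0 \<le> int ?g" using u by auto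
  also have "?g \<le> value_bound e" using c by (simp add: value_bound_def)
  finally have u0_le: "nat (u 0) \<le> max_value e" by (simp add: max_value_def)
  define f where "f = (\<lambda>n. nat (int (offset e) + val n))"
  have f: "int (f n) = int (offset e) + val n" "0 < f n" "f n < max_value e + 1" if "n \<le> e" for n
    using val_le[OF that] by (auto simp: f_def offset_def max_value_def)
  obtain V where V: "V < (max_value e + 1) ^ (e + 1)" "\<forall>n<e + 1. digit (max_value e + 1) V n = f n"
    using ex_digits[of "e + 1" f "max_value e + 1"] f by auto
  have tv: "term_value e V n = f n" if "n \<le> e" for n using V that by (simp add: term_value_def)
  have "values_ok e (nat (u 0)) V"
    unfolding values_ok_def
  proof (intro allI impI conjI)
    fix n assume n: "n \<le> e"
    have le: "psnd n \<le> e" "pfst (psnd n) \<le> e" "psnd (psnd n) \<le> e"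
      using n pfst_le psnd_le by (meson order_trans)+
    show "0 < term_value e V n" using f[OF n] tv[OF n] by simp
    { assume n0: "pfst n = 0"
      let ?k = "?F div (psnd (psnd n) div 2)" and ?i = "pfst (psnd n)"
      have "coeff ?F n = (\<lambda>j. if j = 0 then (int (int_pos ?i) - int (int_neg ?i)) * int ?k else 0)"
        using n0 by (intro ext, subst coeff.simps) simp
      then have "val n = (int (int_pos ?i) - int (int_neg ?i)) * int ?k * u 0"
        by (simp only: val_def sum0)
      then have "int (f n + int_neg ?i * ?k * nat (u 0)) = int (offset e + int_pos ?i * ?k * nat (u 0))"
        using u0 f(1)[OF n] by (simp add: algebra_simps)
      then show "term_value e V n + int_neg ?i * ?k * nat (u 0)
          = offset e + int_pos ?i * ?k * nat (u 0)"
        unfolding tv[OF n] by (simp only: of_nat_eq_iff) }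
    { assume n3: "pfst n = 3"
      have "coeff ?F n j = coeff ?F (pfst (psnd n)) j + coeff ?F (psnd (psnd n)) j" for j
        using n3 by (subst coeff.simps) simp
      then have "val n = val (pfst (psnd n)) + val (psnd (psnd n))"
        by (simp add: val_def distrib_right sum.distrib del: sum.lessThan_Suc)
      then show "term_value e V n + offset e
          = term_value e V (pfst (psnd n)) + term_value e V (psnd (psnd n))"
        using f(1)[OF n] f(1)[OF le(2)] f(1)[OF le(3)] tv[OF n] tv[OF le(2)] tv[OF le(3)] by linarith }
    { assume n4: "pfst n = 4"
      have "coeff ?F n j = coeff ?F (pfst (psnd n)) j - coeff ?F (psnd (psnd n)) j" for j
        using n4 by (subst coeff.simps) simp
      then have "val n = val (pfst (psnd n)) - val (psnd (psnd n))"
        by (simp add: val_def left_diff_distrib sum_subtractf del: sum.lessThan_Suc)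
      then show "term_value e V n + term_value e V (psnd (psnd n))
          = term_value e V (pfst (psnd n)) + offset e"
        using f(1)[OF n] f(1)[OF le(2)] f(1)[OF le(3)] tv[OF n] tv[OF le(2)] tv[OF le(3)] by linarith }
  qed
  moreover have "la_value A \<beta> s < la_value A \<beta> t \<longleftrightarrow>
       term_value e V (encode_la_term s) < term_value e V (encode_la_term t)"
    if "ground s" "ground t" "encode_la_term s \<le> e" "encode_la_term t \<le> e" for s t \<beta>
  proof -
    have "term_value e V (encode_la_term s) < term_value e V (encode_la_term t)
        \<longleftrightarrow> val (encode_la_term s) < val (encode_la_term t)"
      unfolding tv[OF that(3)] tv[OF that(4)] using f(1)[OF that(3)] f(1)[OF that(4)] by linarith
    also have "\<dots> \<longleftrightarrow> la_value A \<beta> s < la_value A \<beta> t"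
      using val_less[OF that(3,4)] la_value_ground[of v e A, OF v] that by (simp add: valv_def)
    finally show ?thesis by simp
  qed
  moreover have "0 < nat (u 0)" using u0 by simp
  ultimately show ?thesis using u0_le V(1) by blast
qed

text \<open>Ground terms prescribe special points only at some indices; the others are filled in
  from left to right, staying below every prescribed value still ahead.\<close>

lemma strict_mono_extension:
  fixes f :: "nat \<Rightarrow> real"
  assumes S: "finite S" and f: "strict_mono_on S f"
  shows "\<exists>p. strict_mono p \<and> (\<forall>s\<in>S. p s = f s)"
proof -
  define U where "U = (\<lambda>n. {s \<in> S. n < s})"
  have fin: "finite (U n)" for n using S by (simp add: U_def)
  \<comment> \<open>A free start lies at least 1 below the later prescribed values;
    \<open>insert 0\<close> keeps the minimum defined if there are none. Any other free index takes
    the midpoint towards the least value ahead, or adds 1 if none is left.\<close>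
  define p where "p = rec_nat (if 0 \<in> S then f 0 else Min (insert 0 (f ` U 0)) - 1)
    (\<lambda>n x. if Suc n \<in> S then f (Suc n)
      else if U (Suc n) = {} then x + 1 else (x + Min (f ` U (Suc n))) / 2)"
  have p0: "p 0 = (if 0 \<in> S then f 0 else Min (insert 0 (f ` U 0)) - 1)"
    and pS: "p (Suc n) = (if Suc n \<in> S then f (Suc n)
      else if U (Suc n) = {} then p n + 1 else (p n + Min (f ` U (Suc n))) / 2)" for n
    by (simp_all add: p_def)
  have on_S: "p s = f s" if "s \<in> S" for s using that by (cases s) (simp_all add: p0 pS)
  have inv: "\<forall>s\<in>U n. p n < f s" for n
  proof (induction n)
    case 0
    show ?case
    proof
      fix s assume s: "s \<in> U 0"
      show "p 0 < f s"
      proof (cases "0 \<in> S")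
        case True
        then show ?thesis using s strict_mono_onD[OF f True, of s] by (simp add: p0 U_def)
      next
        case False
        have "Min (insert 0 (f ` U 0)) \<le> f s" using s fin by (intro Min_le) auto
        then show ?thesis using False by (simp add: p0)
      qed
    qed
  next
    case (Suc n)
    show ?case
    proof
      fix s assume s: "s \<in> U (Suc n)"
      show "p (Suc n) < f s"
      proof (cases "Suc n \<in> S")
        case True
        then show ?thesis using s strict_mono_onD[OF f True, of s] by (simp add: pS U_def)
      next
        case False
        have "Min (f ` U (Suc n)) \<le> f s" using s fin by (intro Min_le) auto
        moreover have "p n < f s" using Suc s by (simp add: U_def)
        ultimately have "(p n + Min (f ` U (Suc n))) / 2 < f s" by simp
        then show ?thesis using False s by (auto simp: pS)
      qed
    qed
  qed
  have "p n < p (Suc n)" for n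
  proof (cases "Suc n \<in> S")
    case True
    then show ?thesis using inv[of n] by (simp add: pS U_def)
  next
    case False
    have "p n < Min (f ` U (Suc n))" if "U (Suc n) \<noteq> {}"
      using that fin inv[of n] by (auto simp: U_def)
    then show ?thesis using False by (simp add: pS)
  qed
  then show ?thesis using on_S by (auto simp: strict_mono_Suc_iff)
qed


section \<open>Homogeneous embeddings\<close>

text \<open>Ramsey's theorem for two colours is applied once for each \<open>d\<close>; passing to
  an infinite subset keeps the homogeneity already reached, whatever the sizes
  \<open>r d\<close>.\<close>

lemma ex_homogeneous:
  fixes Q :: "'d \<Rightarrow> nat set \<Rightarrow> bool" and r :: "'d \<Rightarrow> nat"
  assumes "finite D"
  shows "\<exists>Y. infinite Y \<and>
    (\<forall>d\<in>D. \<exists>t. \<forall>X. X \<subseteq> Y \<and> finite X \<and> card X = r d \<longrightarrow> (Q d X \<longleftrightarrow> t))"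
  using assms
proof induction
  case empty
  show ?case by (rule exI[of _ UNIV]) simp
next
  case (insert d D)
  then obtain Y where Y: "infinite Y"
    "\<forall>d\<in>D. \<exists>t. \<forall>X. X \<subseteq> Y \<and> finite X \<and> card X = r d \<longrightarrow> (Q d X \<longleftrightarrow> t)" by blast
  have "\<forall>X. X \<subseteq> Y \<and> finite X \<and> card X = r d \<longrightarrow> (of_bool (Q d X) :: nat) < 2" by simp
  from Ramsey[OF Y(1) this] obtain Z t where Z: "Z \<subseteq> Y" "infinite Z"
    "\<forall>X. X \<subseteq> Z \<and> finite X \<and> card X = r d \<longrightarrow> of_bool (Q d X) = (t :: nat)" by blast
  have "\<forall>X. X \<subseteq> Z \<and> finite X \<and> card X = r d \<longrightarrow> (Q d X \<longleftrightarrow> t = 1)"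
  proof (intro allI impI)
    fix X assume "X \<subseteq> Z \<and> finite X \<and> card X = r d"
    from Z(3)[rule_format, OF this] show "Q d X \<longleftrightarrow> t = 1" by (cases "Q d X") auto
  qed
  moreover have "\<exists>t. \<forall>X. X \<subseteq> Z \<and> finite X \<and> card X = r d' \<longrightarrow> (Q d' X \<longleftrightarrow> t)" if d': "d' \<in> D" for d'
  proof -
    obtain t where "\<forall>X. X \<subseteq> Y \<and> finite X \<and> card X = r d' \<longrightarrow> (Q d' X \<longleftrightarrow> t)"
      using Y(2) d' by blast
    then show ?thesis using order_trans[OF _ Z(1)] by (intro exI[of _ t]) simp
  qed
  ultimately show ?case using Z(2) by blast
qed

text \<open>Equal kernels induce a bijection between the images.\<close>

lemma card_image_eq_card_image:
  assumes "\<And>j k. j \<in> J \<Longrightarrow> k \<in> J \<Longrightarrow> f j = f k \<longleftrightarrow> g j = g k"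
  shows "card (f ` J) = card (g ` J)"
proof -
  define h where "h = (\<lambda>v. g (inv_into J f v))"
  have h: "h (f j) = g j" if "j \<in> J" for j
    unfolding h_def using assms[OF inv_into_into[of "f j" f J] that] that
    by (simp add: f_inv_into_f)
  then have "h ` f ` J = g ` J" by (force simp: image_image)
  moreover have "inj_on h (f ` J)" using h assms by (auto intro!: inj_onI)
  ultimately show ?thesis by (metis card_image)
qed

text \<open>Ranks are counted from 0. They let a pattern refer to members of an index set without
  naming them.\<close>

definition nth_element :: "nat set \<Rightarrow> nat \<Rightarrow> nat" where
  "nth_element X r = (THE y. y \<in> X \<and> card {z \<in> X. z < y} = r)"

lemma nth_element_image:
  fixes h :: "nat \<Rightarrow> nat"
  assumes h: "strict_mono h" and X: "finite X" "x \<in> X"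
  shows "nth_element (h ` X) (card {y \<in> X. y < x}) = h x"
  unfolding nth_element_def
proof (rule the_equality)
  have "{z \<in> h ` X. z < h x} = h ` {y \<in> X. y < x}" using strict_mono_less[OF h] by auto
  then show "h x \<in> h ` X \<and> card {z \<in> h ` X. z < h x} = card {y \<in> X. y < x}"
    using X h by (simp add: card_image strict_mono_imp_inj_on inj_on_subset)
  then have c: "card {z \<in> h ` X. z < h x} = card {y \<in> X. y < x}" ..
  fix y assume y: "y \<in> h ` X \<and> card {z \<in> h ` X. z < y} = card {y \<in> X. y < x}"
  have less: "card {z \<in> h ` X. z < a} < card {z \<in> h ` X. z < b}" if "a < b" "a \<in> h ` X" for a b
  proof (rule psubset_card_mono)
    show "finite {z \<in> h ` X. z < b}" using X by simp
    show "{z \<in> h ` X. z < a} \<subset> {z \<in> h ` X. z < b}" using that by fastforce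
  qed
  have hx: "h x \<in> h ` X" using X by simp
  show "y = h x"
  proof (rule linorder_cases[of y "h x"])
    assume "y < h x"
    from less[OF this] y c show ?thesis by simp
  next
    assume "h x < y"
    from less[OF this hx] y c show ?thesis by simp
  qed
qed

text \<open>The quotient by \<open>g\<close> counts the positive multiples up to \<open>x\<close>,
  and divisibility separates a special point from the open interval behind it. The number 0 is
  excluded because it lies in the leftmost interval.\<close>

lemma same_cell_multiples:
  fixes g :: nat
  assumes same: "same_cell M (\<lambda>m. g * m) (\<lambda>m. g * m) x y"
    and "x < g * (M + 1)" "y < g * (M + 1)"
  shows "x div g = y div g" "x \<noteq> 0 \<and> g dvd x \<longleftrightarrow> y \<noteq> 0 \<and> g dvd y"
proof -
  have g: "g > 0" using assms(2) by (cases g) auto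
  have *: "\<not> a div g < b div g"
    if "same_cell M (\<lambda>m. g * m) (\<lambda>m. g * m) a b" "b < g * (M + 1)" for a b
  proof
    assume less: "a div g < b div g"
    have "b div g \<le> M" using that(2) g by (metis Suc_eq_plus1 less_Suc_eq_le less_mult_imp_div_less mult.commute)
    moreover have "a < g * (b div g)" using less g by (simp add: div_less_iff_less_mult mult.commute)
    moreover have "\<not> b < g * (b div g)" by (simp add: not_less)
    ultimately show False using that(1) less unfolding same_cell_def by auto
  qed
  have sym: "same_cell M (\<lambda>m. g * m) (\<lambda>m. g * m) y x" using same by (simp add: same_cell_def)
  show eq: "x div g = y div g" using *[OF same] *[OF sym] assms by (meson linorder_neqE_nat)
  have sp: "b \<noteq> 0 \<and> g dvd b" if "same_cell M (\<lambda>m. g * m) (\<lambda>m. g * m) a b" "a < g * (M + 1)"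
    and a: "a \<noteq> 0 \<and> g dvd a" for a b
  proof -
    obtain m where m: "a = g * m" "m > 0" using a by auto
    have "m < M + 1" using that(2) unfolding m(1) mult_less_cancel1 by blast
    then have "m \<le> M" by simp
    then have "b = g * m" using that(1) m unfolding same_cell_def by (metis less_irrefl linorder_neqE_nat)
    then show ?thesis using m g by simp
  qed
  show "x \<noteq> 0 \<and> g dvd x \<longleftrightarrow> y \<noteq> 0 \<and> g dvd y"
    using sp[OF same assms(2)] sp[OF sym assms(3)] by blast
qed

text \<open>Ramsey's theorem is applied to the indices of fixed increasing sequences inside the cells. The
  indices are assigned in the order of the base-sort values, across all cells at once, so one
  homogeneous set of indices serves all cells.\<close>

lemma ex_homogeneous_embedding:
  fixes p :: "nat \<Rightarrow> real" and Q :: "nat \<Rightarrow> (real + 'c) list \<Rightarrow> bool"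
  assumes p: "strict_mono p" and g: "g > 1" and C: "finite C"
  shows "\<exists>\<Phi>. strict_mono \<Phi> \<and> (\<forall>m>0. \<Phi> (g * m) = p m) \<and>
    (\<forall>P\<le>e. \<forall>xs ys. length xs \<le> e \<and> set xs \<subseteq> {..<g * (M + 1)} <+> C \<and>
      set ys \<subseteq> {..<g * (M + 1)} <+> C \<and>
      same_type M (\<lambda>m. g * m) (\<lambda>m. g * m) xs ys \<longrightarrow>
      (Q P (map (map_sum \<Phi> id) xs) \<longleftrightarrow> Q P (map (map_sum \<Phi> id) ys)))"
proof -
  define S where "S = (\<lambda>x. x \<noteq> 0 \<and> g dvd x)"
  \<comment> \<open>The weights \<open>(i + 1) / (i + 2)\<close> increase strictly between 0 and 1,
    which keeps \<open>z m\<close> between \<open>p m\<close> and \<open>p (Suc m)\<close>.\<close>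
  define z where "z = (\<lambda>m i. p m + (p (Suc m) - p m) * (real i + 1) / (real i + 2))"
  have gap: "0 < p (Suc m) - p m" for m using strict_monoD[OF p, of m "Suc m"] by simp
  have z: "p m < z m i" "z m i < p (Suc m)" "i < j \<Longrightarrow> z m i < z m j" for m i j
  proof -
    show "p m < z m i" using gap[of m] by (simp add: z_def)
    have "(p (Suc m) - p m) * ((real i + 1) / (real i + 2)) < (p (Suc m) - p m) * 1"
      using gap[of m] by (intro mult_strict_left_mono) simp_all
    then show "z m i < p (Suc m)" by (simp add: z_def)
    assume "i < j"
    then have "(real i + 1) / (real i + 2) < (real j + 1) / (real j + 2)" by (simp add: field_simps)
    then have "(p (Suc m) - p m) * ((real i + 1) / (real i + 2))
        < (p (Suc m) - p m) * ((real j + 1) / (real j + 2))"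
      using gap[of m] by (intro mult_strict_left_mono)
    then show "z m i < z m j" by (simp add: z_def)
  qed
  \<comment> \<open>Evaluates an entry of a pattern: special or not, cell number, and rank in the
    index set \<open>X\<close>. Such sets \<open>X\<close> are what Ramsey's theorem
    colours.\<close>
  define val where "val = (\<lambda>X (s, m, r). if s then p m else z m (nth_element X r))"
  \<comment> \<open>One colouring for each predicate, size of the index set and pattern of
    arguments: finitely many in all.\<close>
  define D where "D = {..e} \<times> {..e} \<times> {ds. set ds \<subseteq> ((UNIV :: bool set) \<times> {..M} \<times> {..e}) <+> C \<and> length ds \<le> e}"
  have "finite D" unfolding D_def using C
    by (intro finite_cartesian_product finite_lists_length_le finite_Plus) simp_all
  from ex_homogeneous[OF this, where r = "\<lambda>(P, k, ds). k"
      and Q = "\<lambda>(P, k, ds) X. Q P (map (map_sum (val X) id) ds)"]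
  obtain Y where Y: "infinite Y" and hom: "\<And>P k ds. (P, k, ds) \<in> D \<Longrightarrow>
      \<exists>t. \<forall>X. X \<subseteq> Y \<and> finite X \<and> card X = k \<longrightarrow> (Q P (map (map_sum (val X) id) ds) \<longleftrightarrow> t)"
    by (metis (mono_tags, lifting) case_prod_conv)
  define h where "h = enumerate Y"
  have h: "strict_mono h" "range h \<subseteq> Y"
    using Y by (auto simp: h_def strict_mono_enumerate enumerate_in_set)
  \<comment> \<open>A position that is not special uses the index \<open>h x\<close> whatever its
    cell, so larger positions have larger indices.\<close>
  define \<Phi> where "\<Phi> = (\<lambda>x. if S x then p (x div g) else z (x div g) (h x))"
  have "strict_mono \<Phi>"
  proof (rule strict_monoI)
    fix x y :: nat assume xy: "x < y"
    have "\<Phi> x < p (Suc (x div g))" using z(2) strict_monoD[OF p] by (simp add: \<Phi>_def)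
    moreover have "p (y div g) \<le> \<Phi> y" using z(1)[THEN less_imp_le] by (simp add: \<Phi>_def)
    moreover have "p (Suc (x div g)) \<le> p (y div g)" if "x div g < y div g"
      using that p by (simp add: strict_mono_less_eq)
    moreover have "\<Phi> x < \<Phi> y" if eq: "x div g = y div g"
    proof -
      have "\<not> S y"
      proof
        assume "S y"
        then have "y = g * (x div g)" by (simp add: S_def eq)
        then show False using xy times_div_less_eq_dividend[of g x] by linarith
      qed
      then show ?thesis using eq z(1,3) strict_monoD[OF h(1) xy] by (simp add: \<Phi>_def)
    qed
    ultimately show "\<Phi> x < \<Phi> y" using div_le_mono[of x y g] xy by fastforce
  qed
  moreover have "\<Phi> (g * m) = p m" if "m > 0" for m using that g by (simp add: \<Phi>_def S_def)
  moreover have "Q P (map (map_sum \<Phi> id) xs) \<longleftrightarrow> Q P (map (map_sum \<Phi> id) ys)"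
    if P: "P \<le> e" and len: "length xs \<le> e" and xs: "set xs \<subseteq> {..<g * (M + 1)} <+> C"
      and ys: "set ys \<subseteq> {..<g * (M + 1)} <+> C"
      and type: "same_type M (\<lambda>m. g * m) (\<lambda>m. g * m) xs ys" for P xs ys
  proof -
    \<comment> \<open>Only entries that are not special consume indices. The pattern
      \<open>desc\<close> keeps of each base-sort entry its cell and its rank in this set.\<close>
    define F where "F = (\<lambda>xs :: (nat + 'c) list. {x. Inl x \<in> set xs \<and> \<not> S x})"
    define desc where "desc = (\<lambda>xs :: (nat + 'c) list.
      map (map_sum (\<lambda>x. (S x, x div g, card {y \<in> F xs. y < x})) id) xs)"
    have F_fin: "finite (F xs)" for xs
      by (rule finite_subset[of _ "projl ` set xs"]) (force simp: F_def)+
    have F_card: "card (F xs) \<le> length xs" for xs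
    proof -
      have "F xs \<subseteq> projl ` set xs" by (force simp: F_def)
      then have "card (F xs) \<le> card (projl ` set xs)" by (intro card_mono) auto
      also have "\<dots> \<le> length xs" using card_image_le card_length by (meson List.finite_set order_trans)
      finally show ?thesis .
    qed
    \<comment> \<open>The image of a tuple is recovered from its pattern and the image of
      \<open>F xs\<close> under \<open>h\<close>, so its truth under \<open>Q P\<close> is the
      colour of that index set.\<close>
    have val_desc: "map (map_sum (val (h ` F xs)) id) (desc xs) = map (map_sum \<Phi> id) xs" for xs
    proof -
      have "map_sum (val (h ` F xs)) id (map_sum (\<lambda>x. (S x, x div g, card {y \<in> F xs. y < x})) id a)
          = map_sum \<Phi> id a" if "a \<in> set xs" for a
      proof (cases a)
        case (Inl x)
        then show ?thesis
          using that nth_element_image[OF h(1) F_fin, of x xs]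
          by (cases "S x") (simp_all add: val_def \<Phi>_def F_def)
      qed simp
      then show ?thesis by (simp add: desc_def)
    qed
    have len_eq: "length ys = length xs" using type by (simp add: same_type_def)
    have isl: "isl (ys ! i) \<longleftrightarrow> isl (xs ! i)" if "i < length xs" for i
      using type that by (simp add: same_type_def)
    have entry: "projl (xs ! i) div g = projl (ys ! i) div g" "S (projl (xs ! i)) \<longleftrightarrow> S (projl (ys ! i))"
      if i: "i < length xs" "isl (xs ! i)" for i
    proof -
      have cell: "same_cell M (\<lambda>m. g * m) (\<lambda>m. g * m) (projl (xs ! i)) (projl (ys ! i))"
        using type i by (simp add: same_type_def)
      have "xs ! i \<in> {..<g * (M + 1)} <+> C" "ys ! i \<in> {..<g * (M + 1)} <+> C"
        using xs ys i len_eq by (metis nth_mem subsetD)+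
      then have "projl (xs ! i) < g * (M + 1)" "projl (ys ! i) < g * (M + 1)"
        using i isl[OF i(1)] by (auto simp: isl_def)
      from same_cell_multiples[OF cell this] show "projl (xs ! i) div g = projl (ys ! i) div g"
        "S (projl (xs ! i)) \<longleftrightarrow> S (projl (ys ! i))" by (simp_all add: S_def)
    qed
    have less: "projl (xs ! i) < projl (xs ! j) \<longleftrightarrow> projl (ys ! i) < projl (ys ! j)"
      if "i < length xs" "j < length xs" "isl (xs ! i)" "isl (xs ! j)" for i j
      using type that by (simp add: same_type_def)
    have card_eq: "card ((\<lambda>j. projl (xs ! j)) ` J) = card ((\<lambda>j. projl (ys ! j)) ` J)"
      if "J \<subseteq> {j. j < length xs \<and> isl (xs ! j)}" for J
    proof (rule card_image_eq_card_image)
      fix j k assume "j \<in> J" "k \<in> J"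
      then show "projl (xs ! j) = projl (xs ! k) \<longleftrightarrow> projl (ys ! j) = projl (ys ! k)"
        using less[of j k] less[of k j] that by (auto simp: eq_iff not_less[symmetric])
    qed
    have F_eq: "F zs = (\<lambda>j. projl (zs ! j)) ` {j. j < length zs \<and> isl (zs ! j) \<and> \<not> S (projl (zs ! j))}"
      for zs
    proof -
      have "x \<in> F zs \<longleftrightarrow> (\<exists>j<length zs. zs ! j = Inl x) \<and> \<not> S x" for x
        by (auto simp: F_def in_set_conv_nth)
      then show ?thesis by (auto simp: isl_def image_iff) (metis sum.sel(1))
    qed
    let ?J = "{j. j < length xs \<and> isl (xs ! j) \<and> \<not> S (projl (xs ! j))}"
    have J: "{j. j < length ys \<and> isl (ys ! j) \<and> \<not> S (projl (ys ! j))} = ?J"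
      using len_eq isl entry(2) by auto
    have F_xs: "F xs = (\<lambda>j. projl (xs ! j)) ` ?J" by (rule F_eq)
    have F_ys: "F ys = (\<lambda>j. projl (ys ! j)) ` ?J" unfolding F_eq[of ys] J ..
    have cF: "card (F xs) = card (F ys)" unfolding F_xs F_ys by (rule card_eq) auto
    have rank: "card {y \<in> F xs. y < projl (xs ! i)} = card {y \<in> F ys. y < projl (ys ! i)}"
      if i: "i < length xs" "isl (xs ! i)" for i
    proof -
      let ?K = "{j \<in> ?J. projl (xs ! j) < projl (xs ! i)}"
      have "{y \<in> F xs. y < projl (xs ! i)} = (\<lambda>j. projl (xs ! j)) ` ?K" unfolding F_xs by auto
      moreover have "{y \<in> F ys. y < projl (ys ! i)} = (\<lambda>j. projl (ys ! j)) ` ?K"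
        unfolding F_ys using less[OF _ i(1) _ i(2)] by auto
      ultimately show ?thesis using card_eq[of ?K] by auto
    qed
    have desc_eq: "desc ys = desc xs"
    proof (rule nth_equalityI)
      show "length (desc ys) = length (desc xs)" by (simp add: desc_def len_eq)
      fix i assume "i < length (desc ys)"
      then have i: "i < length xs" "i < length ys" by (simp_all add: desc_def len_eq)
      show "desc ys ! i = desc xs ! i"
      proof (cases "xs ! i")
        case (Inl x)
        then obtain y where y: "ys ! i = Inl y" using isl[OF i(1)] by (auto simp: isl_def)
        show ?thesis using i Inl y entry[OF i(1)] rank[OF i(1)] by (simp add: desc_def)
      next
        case (Inr c)
        then obtain d where d: "ys ! i = Inr d" using isl[OF i(1)] by (cases "ys ! i") auto
        have "c = d" using type i(1) Inr d by (force simp: same_type_def)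
        then show ?thesis using i Inr d by (simp add: desc_def)
      qed
    qed
    have "(P, card (F xs), desc xs) \<in> D"
    proof -
      have "map_sum (\<lambda>x. (S x, x div g, card {y \<in> F xs. y < x})) id a
          \<in> ((UNIV :: bool set) \<times> {..M} \<times> {..e}) <+> C" if "a \<in> set xs" for a
      proof (cases a)
        case (Inl x)
        then have "x < g * (M + 1)" using xs that by auto
        then have "x div g \<le> M" using g by (metis Suc_eq_plus1 less_Suc_eq_le less_mult_imp_div_less mult.commute)
        moreover have "card {y \<in> F xs. y < x} \<le> e"
          using card_mono[OF F_fin, of "{y \<in> F xs. y < x}" xs] F_card[of xs] len by force
        ultimately show ?thesis using Inl by (auto intro: InlI)
      next
        case (Inr c)
        then show ?thesis using xs that by auto
      qed
      then show ?thesis using P len F_card[of xs] by (auto simp: D_def desc_def)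
    qed
    \<comment> \<open>Tuples of one type share the pattern and the size of the index set; only the
      index sets differ, and these have one colour.\<close>
    from hom[OF this] obtain t where t: "\<And>X. X \<subseteq> Y \<and> finite X \<and> card X = card (F xs) \<Longrightarrow>
        (Q P (map (map_sum (val X) id) (desc xs)) \<longleftrightarrow> t)" by blast
    have hF: "h ` F zs \<subseteq> Y \<and> finite (h ` F zs) \<and> card (h ` F zs) = card (F zs)" for zs
      using h F_fin by (auto simp: card_image strict_mono_imp_inj_on inj_on_subset)
    have "Q P (map (map_sum \<Phi> id) xs) \<longleftrightarrow> t" using t[OF hF] val_desc by metis
    moreover have "Q P (map (map_sum \<Phi> id) ys) \<longleftrightarrow> t"
      using t[of "h ` F ys"] hF[of ys] val_desc[of ys] cF desc_eq by metis
    ultimately show ?thesis by simp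
  qed
  ultimately show ?thesis by blast
qed


section \<open>From a model to a table\<close>

lemma la_value_ground_cong: "ground t \<Longrightarrow> la_value A \<beta> t = la_value A \<beta>' t"
  by (induction t) simp_all

text \<open>Since strict comparisons correspond, equal numbers force equal values. The value of a
  ground term is therefore a strictly increasing function of its number, and this function extends
  to all indices.\<close>

lemma ex_special_points:
  assumes tv: "\<And>s t. ground s \<Longrightarrow> ground t \<Longrightarrow> encode_la_term s \<le> e \<Longrightarrow> encode_la_term t \<le> e \<Longrightarrow>
      la_value A (\<lambda>_. 0) s < la_value A (\<lambda>_. 0) t \<longleftrightarrow>
      term_value e V (encode_la_term s) < term_value e V (encode_la_term t)"
  shows "\<exists>p. strict_mono p \<and> (\<forall>t \<beta>. ground t \<and> encode_la_term t \<le> e \<longrightarrow>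
    la_value A \<beta> t = p (term_value e V (encode_la_term t)))"
proof -
  define G where "G = {t. ground t \<and> encode_la_term t \<le> e}"
  define k where "k = (\<lambda>t. term_value e V (encode_la_term t))"
  define val where "val = la_value A (\<lambda>_. 0)"
  have less: "val s < val t \<longleftrightarrow> k s < k t" if "s \<in> G" "t \<in> G" for s t
    using tv that by (simp add: G_def k_def val_def)
  then have eq: "val s = val t" if "s \<in> G" "t \<in> G" "k s = k t" for s t
    using that by (metis less_irrefl linorder_neqE_linordered_idom)
  define f where "f = (\<lambda>m. val (inv_into G k m))"
  have f: "f (k t) = val t" if "t \<in> G" for t
    unfolding f_def using that by (intro eq) (auto intro: inv_into_into f_inv_into_f)
  have "k ` G \<subseteq> (\<lambda>n. term_value e V n) ` {..e}" by (auto simp: G_def k_def)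
  then have "finite (k ` G)" by (rule finite_subset) simp
  moreover have "strict_mono_on (k ` G) f"
  proof (rule strict_mono_onI)
    fix m n assume "m \<in> k ` G" "n \<in> k ` G" "m < n"
    then show "f m < f n" using f less by auto
  qed
  ultimately obtain p where p: "strict_mono p" "\<forall>m\<in>k ` G. p m = f m"
    using strict_mono_extension by blast
  have "la_value A \<beta> t = p (term_value e V (encode_la_term t))" if "ground t" "encode_la_term t \<le> e"
    for t \<beta>
  proof -
    have "t \<in> G" using that by (simp add: G_def)
    then have "p (k t) = val t" using p(2) f by simp
    then show ?thesis using la_value_ground_cong[OF that(1)] by (simp add: k_def val_def)
  qed
  then show ?thesis using p(1) by blast
qed

text \<open>The table records truth in \<open>A\<close> after positions are mapped by
  \<open>\<Phi>\<close> and names by \<open>g\<close>. It satisfies the clauses because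
  \<open>A\<close> does at the mapped assignments, and it is uniform because \<open>\<Phi>\<close>
  is homogeneous.\<close>

lemma satisfiable_has_uniform_model:
  assumes N: "finite_bsr_slr_clause_set \<Sigma> N" and w: "presents w N"
    and sat: "satisfiable TYPE('s) \<Sigma> N"
  shows "has_uniform_model (encode w)"
proof -
  define e where "e = encode w"
  define B where "B = pos_base e ^ (e + 1)"
  define G where "G = (e + 1) ^ (e + 1)"
  let ?M = "max_value e" and ?q = "\<lambda>m. gap e * m"
  from sat obtain A :: "'s interpretation_data"
    where int: "is_interpretation \<Sigma> A" and models: "\<And>C. C \<in> N \<Longrightarrow> models_clause A C"
    unfolding satisfiable_def by blast
  obtain a0 where a0: "a0 \<in> universe A" using int by (auto simp: is_interpretation_def)
  \<comment> \<open>Every number is treated as a name; those that are no constants of the signature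
    denote one fixed element, which also covers a signature without constants.\<close>
  define g where "g = (\<lambda>n. if n \<in> free_constants \<Sigma> then constant_value A n else a0)"
  have g: "g n \<in> universe A" for n using a0 int by (simp add: g_def is_interpretation_def)
  \<comment> \<open>The least name of an element is its representative. It never exceeds the given
    name, so it fits into a digit to base \<open>e + 1\<close>.\<close>
  define least where "least = (\<lambda>n. LEAST m. g m = g n)"
  have least: "g (least n) = g n" "least n \<le> n" for n
    unfolding least_def by (rule LeastI, rule refl) (rule Least_le, rule refl)
  have least_eq: "least n = least m \<longleftrightarrow> g n = g m" for n m
    using least(1) by (metis least_def)
  obtain \<kappa> where \<kappa>: "\<kappa> < G" "\<forall>n<e + 1. digit (e + 1) \<kappa> n = least n"
    using ex_digits[of "e + 1" least "e + 1"] least(2) by (auto simp: G_def intro: le_less_trans)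
  obtain u V where u: "0 < u" "u \<le> ?M" and V: "V < (?M + 1) ^ (e + 1)" "values_ok e u V"
    and tv: "\<And>s t. ground s \<Longrightarrow> ground t \<Longrightarrow> encode_la_term s \<le> e \<Longrightarrow> encode_la_term t \<le> e \<Longrightarrow>
      la_value A (\<lambda>_. 0) s < la_value A (\<lambda>_. 0) t \<longleftrightarrow>
      term_value e V (encode_la_term s) < term_value e V (encode_la_term t)"
    using ex_term_values[of e A] by blast
  obtain p where p: "strict_mono p" "\<And>t \<beta>. ground t \<Longrightarrow> encode_la_term t \<le> e \<Longrightarrow>
      la_value A \<beta> t = p (term_value e V (encode_la_term t))"
    using ex_special_points[OF tv] by blast
  define Q where "Q = (\<lambda>P xs. map (case_sum Real (\<lambda>n. Elem (g n))) xs \<in> relation A P)"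
  obtain \<Phi> where \<Phi>: "strict_mono \<Phi>" "\<And>m. m > 0 \<Longrightarrow> \<Phi> (gap e * m) = p m"
    and hom: "\<And>P xs ys. P \<le> e \<Longrightarrow> length xs \<le> e \<Longrightarrow>
      set xs \<subseteq> {..<gap e * (?M + 1)} <+> {..e} \<Longrightarrow> set ys \<subseteq> {..<gap e * (?M + 1)} <+> {..e} \<Longrightarrow>
      same_type ?M ?q ?q xs ys \<Longrightarrow>
      Q P (map (map_sum \<Phi> id) xs) \<longleftrightarrow> Q P (map (map_sum \<Phi> id) ys)"
    using ex_homogeneous_embedding[OF p(1), of "gap e" "{..e}" e ?M Q]
    unfolding gap_def by auto
  define tr where "tr = (\<lambda>\<beta> \<gamma> a.
    Q (pfst (psnd a)) (map (map_sum \<Phi> id) (tuple e \<kappa> \<beta> \<gamma> (psnd (psnd a)))))"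
  have of_bool_less: "of_bool b < (2 :: nat)" for b by simp
  obtain T where T: "T < 2 ^ table_size e" "\<forall>n<table_size e.
      digit 2 T n = of_bool (tr (pfst (psnd n)) (psnd (psnd n)) (pfst n))"
    using ex_digits[of "table_size e" "\<lambda>n. of_bool (tr (pfst (psnd n)) (psnd (psnd n)) (pfst n))" 2,
        OF of_bool_less] by blast
  have table: "table T \<beta> \<gamma> a \<longleftrightarrow> tr \<beta> \<gamma> a" if "a \<le> e" "\<beta> < B" "\<gamma> < G" for \<beta> \<gamma> a
  proof -
    have "prod_encode (a, prod_encode (\<beta>, \<gamma>)) < table_size e"
      unfolding table_size_def less_Suc_eq_le using that
      by (intro prod_encode_mono) (simp_all add: B_def G_def)
    then show ?thesis using T(2) by (simp add: table_def)
  qed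
  have uniform: "table T \<beta> \<gamma> a \<longleftrightarrow> table T \<beta>' \<gamma>' a'"
    if a: "a \<le> e" "a' \<le> e" and \<beta>\<gamma>: "\<beta> < B" "\<gamma> < G" "\<beta>' < B" "\<gamma>' < G"
      and sim: "similar e \<kappa> \<beta> \<gamma> a \<beta>' \<gamma>' a'" for \<beta> \<gamma> a \<beta>' \<gamma>' a'
  proof -
    have l: "psnd (psnd b) \<le> e" "pfst (psnd b) \<le> e" if "b \<le> e" for b
      using that psnd_le pfst_le by (meson order_trans)+
    have range: "set (tuple e \<kappa> \<beta> \<gamma> l) \<subseteq> {..<gap e * (?M + 1)} <+> {..e}" for \<beta> \<gamma> l
      using digit_less[of "pos_base e" \<beta>] digit_less[of "e + 1" \<kappa>]
      by (auto simp: tuple_def arg_value_def base_value_def element_def pos_base_def gap_def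
          less_Suc_eq_le intro!: InlI InrI)
    have len: "length (tuple e \<kappa> \<beta> \<gamma> (psnd (psnd a))) \<le> e"
      using length_le_list_encode[of "list_decode (psnd (psnd a))"] l(1)[OF a(1)]
      by (simp add: tuple_def)
    have "same_type ?M ?q ?q (tuple e \<kappa> \<beta> \<gamma> (psnd (psnd a))) (tuple e \<kappa> \<beta>' \<gamma>' (psnd (psnd a')))"
      using sim similar_args_iff[OF l(1)[OF a(1)] l(1)[OF a(2)]] by (simp add: similar_def)
    from hom[OF l(2)[OF a(1)] len range range this] show ?thesis
      using table a \<beta>\<gamma> sim by (simp add: tr_def similar_def)
  qed
  have clauses: "all_list e (\<lambda>c. clause_true e V \<kappa> T \<beta> \<gamma> c)" if \<beta>\<gamma>: "\<beta> < B" "\<gamma> < G" for \<beta> \<gamma>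
    unfolding e_def encode_def all_list_encode
  proof (fold encode_def e_def, intro ballI)
    fix c assume "c \<in> set (map encode_clause w)"
    then obtain ls gs ds where c: "c = encode_clause (ls, gs, ds)" "(ls, gs, ds) \<in> set w" by auto
    define C where "C = Clause (mset ls) (mset gs) (mset ds)"
    have "C \<in> N" using w c(2) by (force simp: presents_def C_def)
    have wf: "\<And>a. a \<in> set ls \<Longrightarrow> slr_atom a" "\<And>a. a \<in> set gs \<union> set ds \<Longrightarrow> wf_free_atom \<Sigma> a"
      using N \<open>C \<in> N\<close> by (auto simp: finite_bsr_slr_clause_set_def bsr_slr_clause_def C_def)
    note le = encode_components_le[OF c(2), folded e_def]
    define \<beta>' where "\<beta>' = (\<lambda>x. \<Phi> (base_value e \<beta> x))"
    define \<gamma>' where "\<gamma>' = (\<lambda>x. g (digit (e + 1) \<gamma> x))"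
    have \<gamma>': "range \<gamma>' \<subseteq> universe A" using g by (auto simp: \<gamma>'_def)
    have el: "\<exists>n\<le>e. element e \<kappa> \<gamma> (encode_free_term t) = least n \<and> free_value A \<gamma>' t = g n"
      if "wf_free_term \<Sigma> t" "encode_free_term t \<le> e" for t
    proof (cases t)
      case (FreeVar x)
      have "digit (e + 1) \<gamma> x < e + 1" by (rule digit_less) simp
      then show ?thesis using \<kappa>(2) FreeVar
        by (intro exI[of _ "digit (e + 1) \<gamma> x"]) (simp add: element_def \<gamma>'_def)
    next
      case (FreeConst c)
      then have "c \<le> e" using that by (auto dest: prod_encode_leD)
      then show ?thesis using \<kappa>(2) FreeConst that
        by (intro exI[of _ c]) (simp add: element_def g_def)
    qed
    have pos: "la_value A \<beta>' t = \<Phi> (position e V \<beta> (encode_la_term t))"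
      if "ground t \<or> is_base_var t" "encode_la_term t \<le> e" for t
    proof (cases "ground t")
      case True
      \<comment> \<open>Positivity lets \<open>\<Phi>\<close> send the multiple of
        \<open>gap e\<close> to the special point that is the value of the term.\<close>
      moreover have "0 < term_value e V (encode_la_term t)" using V(2) that by (simp add: values_ok_def)
      ultimately show ?thesis using p(2) that \<Phi>(2) pfst_encode_ground by (simp add: position_def)
    next
      case False
      then show ?thesis using that by (auto simp: is_base_var_def position_def \<beta>'_def)
    qed
    have la: "la_true e V \<beta> (encode_la_atom a) \<longleftrightarrow> holds_la A \<beta>' a" if a: "a \<in> set ls" for a
    proof -
      obtain r s t where rst: "a = Compare r s t" by (cases a)
      have "ground s \<or> is_base_var s" "ground t \<or> is_base_var t" using wf(1)[OF a] rst by auto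
      moreover have "encode_la_term s \<le> e" "encode_la_term t \<le> e"
        using le(1)[OF a] rst by (auto dest!: prod_encode_leD)
      ultimately have "la_value A \<beta>' s = \<Phi> (position e V \<beta> (encode_la_term s))"
        "la_value A \<beta>' t = \<Phi> (position e V \<beta> (encode_la_term t))" using pos by auto
      then show ?thesis
        using comparison_true_encode[of "la_value A \<beta>' s" "la_value A \<beta>' t"
            "position e V \<beta> (encode_la_term s)" "position e V \<beta> (encode_la_term t)" r]
          strict_mono_less[OF \<Phi>(1)] by (simp add: la_true_def rst)
    qed
    have free: "free_true e \<kappa> T \<beta> \<gamma> (encode_free_atom a) \<longleftrightarrow> holds_free A \<beta>' \<gamma>' a"
      if a: "a \<in> set gs \<union> set ds" for a
    proof (cases a)
      case (Eq s t)
      have "encode_free_term s \<le> e" "encode_free_term t \<le> e"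
        using le(2)[OF a] Eq by (auto dest!: prod_encode_leD)
      moreover have "wf_free_term \<Sigma> s" "wf_free_term \<Sigma> t" using wf(2)[OF a] Eq by auto
      ultimately show ?thesis using el[of s] el[of t] least_eq by (auto simp: free_true_def Eq)
    next
      case (Pred P args)
      let ?l = "list_encode (map encode_argument args)" and ?a = "encode_free_atom a"
      have a_eq: "?a = prod_encode (1, prod_encode (P, ?l))" by (simp add: Pred)
      have a_le: "?a \<le> e" using le(2)[OF a] .
      then have l_le: "?l \<le> e" unfolding a_eq by (blast dest: prod_encode_leD)
      have arg: "case_sum Real (\<lambda>n. Elem (g n)) (map_sum \<Phi> id (arg_value e \<kappa> \<beta> \<gamma> (encode_argument x)))
          = argument_value A \<beta>' \<gamma>' x" if x: "x \<in> set args" for x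
      proof (cases x)
        case (BaseArg y)
        then show ?thesis by (simp add: arg_value_def \<beta>'_def)
      next
        case (FreeArg t)
        have "encode_argument x \<le> e"
          using member_le_list_encode[of "encode_argument x" "map encode_argument args"] x l_le by auto
        then have t_le: "encode_free_term t \<le> e" using FreeArg by (auto dest: prod_encode_leD)
        obtain \<xi>s where "list_all2 (wf_argument \<Sigma>) args \<xi>s" using wf(2)[OF a] Pred by auto
        then obtain \<xi> where "wf_argument \<Sigma> x \<xi>" using x
          by (metis in_set_conv_nth list_all2_conv_all_nth)
        then have "wf_free_term \<Sigma> t" using FreeArg by simp
        from el[OF this t_le] show ?thesis using least(1) by (auto simp: FreeArg arg_value_def)
      qed
      have "tr \<beta> \<gamma> ?a \<longleftrightarrow> map (argument_value A \<beta>' \<gamma>') args \<in> relation A P"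
        using arg by (simp add: tr_def a_eq Q_def tuple_def comp_def cong: map_cong)
      then show ?thesis using table[OF a_le \<beta>\<gamma>] by (simp add: free_true_def Pred)
    qed
    have "(\<forall>a\<in>#mset ls. holds_la A \<beta>' a) \<and> (\<forall>a\<in>#mset gs. holds_free A \<beta>' \<gamma>' a) \<longrightarrow>
        (\<exists>a\<in>#mset ds. holds_free A \<beta>' \<gamma>' a)"
      using models[OF \<open>C \<in> N\<close>] \<gamma>' unfolding models_clause_def C_def clause.sel by blast
    then show "clause_true e V \<kappa> T \<beta> \<gamma> c"
      unfolding c(1) clause_true_encode using la free by auto
  qed
  show ?thesis
    unfolding has_uniform_model_def e_def[symmetric] B_def[symmetric] G_def[symmetric]
    using u V \<kappa>(1) T(1) clauses uniform by blast
qed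

text \<open>The criterion refers to the code alone, so one program serves all signatures and
  presentations. A model over \<open>'s\<close> gives a table and hence a model over
  \<open>nat\<close>; without the latter there is none of the former.\<close>

theorem theorem1:
  shows "\<exists>p. \<forall>\<Sigma> N w.
    finite_signature \<Sigma> \<longrightarrow> finite_bsr_slr_clause_set \<Sigma> N \<longrightarrow> presents w N \<longrightarrow>
    (if satisfiable TYPE(nat) \<Sigma> N then computes p [encode w] 1
     else \<not> satisfiable TYPE('s) \<Sigma> N \<and> computes p [encode w] 0)"
proof -
  obtain p where p: "\<forall>x. if has_uniform_model x then computes p [x] 1 else computes p [x] 0"
    using decidable_computes[OF decidable_has_uniform_model] by blast
  show ?thesis
  proof (intro exI[of _ p] allI impI)
    fix \<Sigma> N w
    assume N: "finite_bsr_slr_clause_set \<Sigma> N" and w: "presents w N"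
    have "satisfiable TYPE(nat) \<Sigma> N" if "satisfiable TYPE('s) \<Sigma> N"
      using has_uniform_model_satisfiable[OF N w] satisfiable_has_uniform_model[OF N w that] .
    moreover have "has_uniform_model (encode w) \<longleftrightarrow> satisfiable TYPE(nat) \<Sigma> N"
      using has_uniform_model_satisfiable[OF N w] satisfiable_has_uniform_model[OF N w] by blast
    ultimately show "if satisfiable TYPE(nat) \<Sigma> N then computes p [encode w] 1
        else \<not> satisfiable TYPE('s) \<Sigma> N \<and> computes p [encode w] 0"
      using p[rule_format, of "encode w"] by (auto split: if_splits)
  qed
qed

end
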